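(* For any non-elliptic map $f\colon\mathbb{D}\to\mathbb{D}$, the following conditions are equivalent: (a) For any $z\in\mathbb{D}$, there exist constants $A\geq1$ and $B\geq0$ so that for all integers $0\leq n<m$, we have $$\sum_{k=n}^{m-1}d_{\mathbb{D}}(f^k(z),f^{k+1}(z)) \leq A\,d_{\mathbb{D}}(f^n(z),f^m(z))+B.$$ (b) The orbit $\{f^n(z)\}$ converges to the Denjoy--Wolff point of $f$ non-tangentially, for some $z\in\mathbb{D}$.
   Context: $\mathbb{D}$ is the open unit disc. A holomorphic map $f\colon\mathbb{D}\to\mathbb{D}$ is non-elliptic if it has no fixed point in $\mathbb{D}$; then there is a unique $\tau\in\partial\mathbb{D}$, the Denjoy--Wolff point of $f$, such that the iterates $f^n(z)$ converge to $\tau$ for all $z\in\mathbb{D}$ ($f^0=\mathrm{Id}$). A sequence $\{z_n\}\subseteq\mathbb{D}$ converging to $\sigma\in\partial\mathbb{D}$ converges non-tangentially if there is $R>1$ with $|\sigma-z_n|<R(1-|z_n|)$ for all $n$. $d_{\mathbb{D}}$ is the hyperbolic distance of $\mathbb{D}$ induced by the metric $\frac{|dz|}{1-|z|^2}$. *)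

theory Defs
  imports "HOL-Complex_Analysis.Complex_Analysis"
begin

abbreviation unit_disc :: "complex set" where
  "unit_disc \<equiv> ball 0 1"

text \<open>
  The distance induced by the Riemannian metric \<open>|dz| / (1 - |z|\<^sup>2)\<close>: the infimum of the lengths of
  piecewise continuously differentiable curves in the disc.  A \<^const>\<open>valid_path\<close> may have an
  unbounded derivative near an exceptional point and hence infinite length.  Asking for
  \<open>has_integral\<close>, instead of taking the value of \<^const>\<open>integral\<close>, leaves such curves out;
  with \<^const>\<open>integral\<close> they would get length \<open>0\<close>.
\<close>
definition hyp_dist :: "complex \<Rightarrow> complex \<Rightarrow> real" where
  "hyp_dist z w = Inf {L. \<exists>\<gamma>. valid_path \<gamma> \<and> path_image \<gamma> \<subseteq> unit_disc \<and>
     pathstart \<gamma> = z \<and> pathfinish \<gamma> = w \<and>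
     ((\<lambda>t. norm (vector_derivative \<gamma> (at t)) / (1 - (norm (\<gamma> t))\<^sup>2)) has_integral L) {0..1}}"

definition non_elliptic :: "(complex \<Rightarrow> complex) \<Rightarrow> bool" where
  "non_elliptic f \<longleftrightarrow> f holomorphic_on unit_disc \<and> f ` unit_disc \<subseteq> unit_disc \<and>
     (\<forall>z\<in>unit_disc. f z \<noteq> z)"

text \<open>The description is proper for non-elliptic maps, by the Denjoy--Wolff theorem.\<close>
definition denjoy_wolff_point :: "(complex \<Rightarrow> complex) \<Rightarrow> complex" where
  "denjoy_wolff_point f =
     (THE \<tau>. \<tau> \<in> sphere 0 1 \<and> (\<forall>z\<in>unit_disc. (\<lambda>n. (f ^^ n) z) \<longlonglongrightarrow> \<tau>))"

definition converges_nontangentially :: "(nat \<Rightarrow> complex) \<Rightarrow> complex \<Rightarrow> bool" where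
  "converges_nontangentially u \<sigma> \<longleftrightarrow>
     \<sigma> \<in> sphere 0 1 \<and> (\<forall>n. u n \<in> unit_disc) \<and> u \<longlonglongrightarrow> \<sigma> \<and>
     (\<exists>R>1. \<forall>n. norm (\<sigma> - u n) < R * (1 - norm (u n)))"

end

theory Submission
  imports Defs
begin

text \<open>
  Wolff's lemma (\<open>Wolff_boundary_point\<close>) gives a boundary point \<open>\<tau>\<close> whose horodiscs are invariant
  under \<open>f\<close>.  After the Cayley transform that sends \<open>\<tau>\<close> to infinity, every orbit becomes a sequence
  \<open>w\<close> in the right half-plane whose real part does not decrease, and the orbit tends to \<open>\<tau>\<close>
  (\<open>Denjoy_Wolff_convergence\<close>), so \<open>\<tau>\<close> is the Denjoy--Wolff point.  Non-tangential convergence means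
  that \<open>w\<close> stays in a sector \<open>|w + 1| \<le> K Re w\<close> (\<open>converges_nontangentially_iff_sector\<close>).  By
  Schwarz--Pick the hyperbolic steps of an orbit are bounded, and so is the distance between two orbits;
  hence it is the same to have non-tangential convergence for one orbit or for all of them.

  The distance of the disc is \<open>artanh\<close> of the pseudo-hyperbolic distance (\<open>hyp_dist_eq_artanh\<close>).  In
  the half-plane, if \<open>Re a \<le> Re b\<close>, it lies between \<open>ln (1 + |b - a| / Re a) / 2\<close> and
  \<open>ln (1 + |b - a| / Re a)\<close> (\<open>artanh_pseudohyp_bounds\<close>).  Both implications follow from this estimate.

  Suppose that the orbit is quasi-geodesic.  Over a stretch where \<open>Re w\<close> at most doubles, a Euclidean
  displacement of \<open>t\<close> units of \<open>Re w\<close> costs hyperbolic length proportional to \<open>t\<close>, while its ends are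
  at distance at most \<open>ln (1 + t)\<close>; so \<open>t\<close> is bounded.  Summing a geometric series over the successive
  doublings gives the sector (\<open>quasi_geodesic_imp_sector\<close>).

  Suppose that the orbit stays in a sector.  The step \<open>p\<close> of the map in the half-plane is itself
  a holomorphic map into the right half-plane, hence nearly constant, up to multiples of \<open>Re p\<close>,
  while \<open>Re w\<close> doubles.  Were it almost vertical somewhere, it would carry the orbit out of the sector
  before \<open>Re w\<close> doubles.  So \<open>|p| \<le> M Re p\<close> along the orbit (\<open>sector_orbit_steps_in_sector\<close>).  Then
  each hyperbolic step is bounded by a multiple of the increment of \<open>ln (Re w)\<close>; the sum telescopes to a
  multiple of \<open>ln (Re (w m) / Re (w n))\<close>, which is at most twice the hyperbolic distance of \<open>w n\<close> and
  \<open>w m\<close> (\<open>steps_in_sector_imp_quasi_geodesic\<close>).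
\<close>

section \<open>The hyperbolic distance\<close>

abbreviation disc_moebius :: "complex \<Rightarrow> complex \<Rightarrow> complex" where
  "disc_moebius \<equiv> Moebius_function 0"

lemma one_minus_cnj_mult_nonzero:
  fixes w z :: complex
  assumes "norm w < 1" "norm z < 1"
  shows "1 - cnj w * z \<noteq> 0"
proof -
  have "norm (cnj w * z) < 1"
    using norm_mult_less[of "cnj w" 1 z 1] assms by simp
  then show ?thesis by auto
qed

text \<open>
  The identity behind the invariance of the metric: it turns \<open>1 - |\<phi>\<^sub>w(z)|\<^sup>2\<close> for a disc automorphism
  \<open>\<phi>\<^sub>w\<close> into \<open>|\<phi>\<^sub>w'(z)| (1 - |z|\<^sup>2)\<close>.
\<close>
lemma norm_one_minus_cnj_mult_sq:
  fixes w z :: complex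
  shows "(norm (1 - cnj w * z))\<^sup>2 - (norm (z - w))\<^sup>2 = (1 - (norm w)\<^sup>2) * (1 - (norm z)\<^sup>2)"
  unfolding cmod_power2 by (simp add: power2_eq_square algebra_simps)

lemma one_minus_norm_moebius_sq:
  assumes "norm w < 1" "norm z < 1"
  shows "1 - (norm (disc_moebius w z))\<^sup>2
          = (1 - (norm w)\<^sup>2) * (1 - (norm z)\<^sup>2) / (norm (1 - cnj w * z))\<^sup>2"
  using one_minus_cnj_mult_nonzero[OF assms] norm_one_minus_cnj_mult_sq[of w z]
  by (simp add: Moebius_function_simple norm_divide power_divide field_simps)

lemma moebius_has_field_derivative:
  assumes "norm w < 1" "norm z < 1"
  shows "(disc_moebius w has_field_derivative (1 - (norm w)\<^sup>2) / (1 - cnj w * z)\<^sup>2) (at z)"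
proof -
  have nz: "1 - cnj w * z \<noteq> 0" by (rule one_minus_cnj_mult_nonzero[OF assms])
  have eq: "complex_of_real (1 - (norm w)\<^sup>2) = 1 - cnj w * w"
    by (simp add: complex_norm_square mult.commute del: of_real_power)
  show ?thesis
    unfolding Moebius_function_simple[abs_def]
    by (rule derivative_eq_intros refl nz)+ (use nz eq in \<open>simp add: field_simps power2_eq_square\<close>)
qed

text \<open>
  Disc automorphisms are isometries of \<open>|dz| / (1 - |z|\<^sup>2)\<close>.  The numerator on the left is the
  derivative of \<open>disc_moebius w\<close> at \<open>z\<close>.
\<close>
lemma moebius_pullback_of_metric:
  assumes "norm w < 1" "norm z < 1"
  shows "norm ((1 - (norm w)\<^sup>2) / (1 - cnj w * z)\<^sup>2 :: complex) / (1 - (norm (disc_moebius w z))\<^sup>2)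
          = 1 / (1 - (norm z)\<^sup>2)"
proof -
  have w: "1 - (norm w)\<^sup>2 > 0" and z: "1 - (norm z)\<^sup>2 > 0"
    using assms by (simp_all add: power_less_one_iff abs_square_less_1)
  have "norm (1 - (complex_of_real (norm w))\<^sup>2) = 1 - (norm w)\<^sup>2"
    using w by (metis norm_of_real of_real_1 of_real_diff of_real_power abs_of_pos)
  then show ?thesis
    using w z one_minus_cnj_mult_nonzero[OF assms]
    by (simp add: one_minus_norm_moebius_sq[OF assms] norm_divide norm_power)
qed

text \<open>
  Move \<open>z\<close> to \<open>0\<close> by an automorphism and rotate so that \<open>w\<close> lands on the positive real axis.  The
  real part \<open>u\<close> of the moved curve runs from \<open>0\<close> to \<open>|\<phi>\<^sub>z(w)|\<close>, and \<open>artanh u\<close> has derivative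
  \<open>u' / (1 - u\<^sup>2)\<close>, which is at most the hyperbolic speed since \<open>|u|\<close> is at most the modulus of the
  moved point.  The real part is used in place of the modulus because it is differentiable at \<open>0\<close>.
\<close>
lemma hyperbolic_length_ge_artanh:
  assumes \<gamma>: "valid_path \<gamma>" "path_image \<gamma> \<subseteq> unit_disc" "pathstart \<gamma> = z" "pathfinish \<gamma> = w"
    and L: "((\<lambda>t. norm (vector_derivative \<gamma> (at t)) / (1 - (norm (\<gamma> t))\<^sup>2)) has_integral L) {0..1}"
  shows "artanh (norm (disc_moebius z w)) \<le> L"
proof -
  have in_disc: "norm (\<gamma> t) < 1" if "t \<in> {0..1}" for t
    using \<gamma>(2) that by (auto simp: path_image_def image_subset_iff)
  have z: "norm z < 1" and w: "norm w < 1"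
    using in_disc[of 0] in_disc[of 1] \<gamma> by (auto simp: pathstart_def pathfinish_def)
  obtain c where c: "norm c = 1" "c * disc_moebius z w = norm (disc_moebius z w)"
  proof (cases "disc_moebius z w = 0")
    case False
    then show ?thesis
      by (intro that[of "norm (disc_moebius z w) / disc_moebius z w"]) (auto simp: norm_divide)
  qed (use that[of 1] in auto)
  define u where "u t = Re (c * disc_moebius z (\<gamma> t))" for t
  have u_le: "\<bar>u t\<bar> \<le> norm (disc_moebius z (\<gamma> t))" for t
    unfolding u_def using abs_Re_le_cmod[of "c * disc_moebius z (\<gamma> t)"] c(1) by (simp add: norm_mult)
  have u_less: "\<bar>u t\<bar> < 1" if "t \<in> {0..1}" for t
    using u_le[of t] Moebius_function_norm_lt_1[OF z in_disc[OF that], of 0] by linarith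
  obtain S where S: "finite S" "\<And>t. t \<in> {0..1} - S \<Longrightarrow> \<gamma> differentiable at t"
    and cont: "continuous_on {0..1} \<gamma>"
    using \<gamma>(1) unfolding valid_path_def piecewise_C1_differentiable_on_def C1_differentiable_on_eq
    by blast
  define D where "D t = c * ((1 - (norm z)\<^sup>2) / (1 - cnj z * \<gamma> t)\<^sup>2) * vector_derivative \<gamma> (at t)" for t
  \<comment> \<open>The derivative of \<open>artanh (u t)\<close>, set to \<open>0\<close> where \<open>\<gamma>\<close> may have a corner; the integrand of the
     length is nonnegative there, so the pointwise comparison below holds on the whole interval.\<close>
  define v' where "v' t = (if t \<in> {0<..<1} - S then Re (D t) / (1 - (u t)\<^sup>2) else 0)" for t
  have v'_int: "(v' has_integral artanh (u 1) - artanh (u 0)) {0..1}"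
  proof (rule fundamental_theorem_of_calculus_interior_strong[OF S(1)])
    fix t assume t: "t \<in> {0<..<1} - S"
    then have t01: "t \<in> {0..1}" by auto
    have "(\<gamma> has_vector_derivative vector_derivative \<gamma> (at t)) (at t)"
      using S(2)[of t] t by (simp add: vector_derivative_works)
    from field_vector_diff_chain_at[OF this moebius_has_field_derivative[OF z in_disc[OF t01]]]
    have "((\<lambda>t. c * disc_moebius z (\<gamma> t)) has_vector_derivative D t) (at t)"
      by (drule_tac has_vector_derivative_mult_right[where a = c]) (simp add: o_def D_def mult_ac)
    then have "(u has_vector_derivative Re (D t)) (at t)"
      unfolding u_def[abs_def] by (rule bounded_linear.has_vector_derivative[OF bounded_linear_Re])
    then have "(u has_field_derivative Re (D t)) (at t)"
      by (simp add: has_real_derivative_iff_has_vector_derivative)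
    from DERIV_chain2[OF artanh_real_has_field_derivative[OF u_less[OF t01]] this]
    have "((\<lambda>t. artanh (u t)) has_field_derivative v' t) (at t)"
      using t by (simp add: v'_def)
    then show "((\<lambda>t. artanh (u t)) has_vector_derivative v' t) (at t)"
      by (simp add: has_real_derivative_iff_has_vector_derivative)
  next
    have "continuous_on (ball 0 1) (disc_moebius z)"
      using Moebius_function_holomorphic[OF z] holomorphic_on_imp_continuous_on by blast
    then have "continuous_on {0..1} (\<lambda>t. disc_moebius z (\<gamma> t))"
      by (rule continuous_on_compose2[OF _ cont]) (use in_disc in auto)
    then have "continuous_on {0..1} u"
      unfolding u_def by (intro continuous_intros)
    then show "continuous_on {0..1} (\<lambda>t. artanh (u t))"
      using u_less by (intro continuous_on_artanh') (auto simp: abs_less_iff minus_less_iff)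
  qed auto
  have v'_le: "v' t \<le> norm (vector_derivative \<gamma> (at t)) / (1 - (norm (\<gamma> t))\<^sup>2)"
    if t: "t \<in> {0..1}" for t
  proof (cases "t \<in> {0<..<1} - S")
    case False
    then show ?thesis using in_disc[OF t] by (auto simp: v'_def power_le_one abs_square_le_1)
  next
    case True
    have lt: "(norm (disc_moebius z (\<gamma> t)))\<^sup>2 < 1"
      using Moebius_function_norm_lt_1[OF z in_disc[OF t], of 0] by (simp add: abs_square_less_1)
    have nD: "norm (D t) = norm (vector_derivative \<gamma> (at t)) *
        norm ((1 - (norm z)\<^sup>2) / (1 - cnj z * \<gamma> t)\<^sup>2 :: complex)"
      unfolding D_def norm_mult c(1) mult_1_left by (rule mult.commute)
    have "(u t)\<^sup>2 \<le> (norm (disc_moebius z (\<gamma> t)))\<^sup>2"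
      using u_le[of t] by (simp add: abs_le_square_iff[symmetric])
    then have "v' t \<le> norm (D t) / (1 - (norm (disc_moebius z (\<gamma> t)))\<^sup>2)"
      using True lt complex_Re_le_cmod[of "D t"]
      by (simp add: v'_def) (intro frac_le; simp)
    also have "\<dots> = norm (vector_derivative \<gamma> (at t)) *
        (norm ((1 - (norm z)\<^sup>2) / (1 - cnj z * \<gamma> t)\<^sup>2 :: complex) / (1 - (norm (disc_moebius z (\<gamma> t)))\<^sup>2))"
      unfolding nD by (rule times_divide_eq_right[symmetric])
    also have "\<dots> = norm (vector_derivative \<gamma> (at t)) / (1 - (norm (\<gamma> t))\<^sup>2)"
      by (subst moebius_pullback_of_metric[OF z in_disc[OF t]]) simp
    finally show ?thesis .
  qed
  have "artanh (u 1) - artanh (u 0) \<le> L"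
    by (rule has_integral_le[OF v'_int L v'_le])
  moreover have "u 0 = 0" "u 1 = norm (disc_moebius z w)"
    using \<gamma> c by (auto simp: u_def pathstart_def pathfinish_def Moebius_function_eq_zero)
  ultimately show ?thesis by simp
qed

text \<open>
  The lower bound is attained by the image of a radius under the automorphism that takes \<open>0\<close> to \<open>z\<close>.
\<close>
lemma hyperbolic_geodesic:
  assumes z: "norm z < 1" and w: "norm w < 1"
  obtains \<gamma> where "valid_path \<gamma>" "path_image \<gamma> \<subseteq> unit_disc" "pathstart \<gamma> = z" "pathfinish \<gamma> = w"
    "((\<lambda>t. norm (vector_derivative \<gamma> (at t)) / (1 - (norm (\<gamma> t))\<^sup>2))
        has_integral artanh (norm (disc_moebius z w))) {0..1}"
proof -
  define \<zeta> where "\<zeta> = disc_moebius z w"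
  have \<zeta>: "norm \<zeta> < 1" unfolding \<zeta>_def by (rule Moebius_function_norm_lt_1[OF z w])
  have mz: "norm (-z) < 1" using z by simp
  define \<gamma> where "\<gamma> t = disc_moebius (-z) (of_real t * \<zeta>)" for t
  have lt: "norm (of_real t * \<zeta>) < 1" if "t \<in> {0..1}" for t
    using that \<zeta> by (auto simp: norm_mult mult_le_one intro: le_less_trans[OF mult_left_le_one_le])
  define d where "d t = (1 - (norm (-z))\<^sup>2) / (1 - cnj (-z) * (of_real t * \<zeta>))\<^sup>2" for t :: real
  have deriv: "(\<gamma> has_vector_derivative \<zeta> * d t) (at t)" if "t \<in> {0..1}" for t
  proof -
    have "((\<lambda>t. of_real t * \<zeta>) has_vector_derivative \<zeta>) (at t)"
      by (auto intro!: derivative_eq_intros)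
    from field_vector_diff_chain_at[OF this moebius_has_field_derivative[OF mz lt[OF that]]]
    show ?thesis by (simp add: o_def \<gamma>_def[abs_def] d_def)
  qed
  have vd: "vector_derivative \<gamma> (at t) = \<zeta> * d t" if "t \<in> {0..1}" for t
    using deriv[OF that] by (rule vector_derivative_at)
  show ?thesis
  proof (rule that)
    have "continuous_on {0..1} (\<lambda>t. \<zeta> * d t)"
      unfolding d_def using one_minus_cnj_mult_nonzero[OF mz lt]
      by (intro continuous_intros) auto
    then have "continuous_on {0..1} (\<lambda>t. vector_derivative \<gamma> (at t))"
      by (subst continuous_on_cong[OF refl vd])
    then have "\<gamma> C1_differentiable_on {0..1}"
      unfolding C1_differentiable_on_eq using deriv differentiableI_vector by blast
    then show "valid_path \<gamma>"
      by (simp add: valid_path_def C1_differentiable_imp_piecewise)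
    show "path_image \<gamma> \<subseteq> unit_disc"
      using Moebius_function_norm_lt_1[OF mz lt] by (auto simp: path_image_def \<gamma>_def)
    show "pathstart \<gamma> = z" by (simp add: pathstart_def \<gamma>_def Moebius_function_of_zero)
    show "pathfinish \<gamma> = w"
      using Moebius_function_compose[of "-z" z w] z w by (simp add: pathfinish_def \<gamma>_def \<zeta>_def)
    have "((\<lambda>t. norm \<zeta> / (1 - (t * norm \<zeta>)\<^sup>2)) has_integral
            artanh (1 * norm \<zeta>) - artanh (0 * norm \<zeta>)) {0..1}"
    proof (rule fundamental_theorem_of_calculus)
      fix t :: real assume t: "t \<in> {0..1}"
      have "\<bar>t * norm \<zeta>\<bar> < 1" using lt[OF t] t by (simp add: norm_mult)
      then have "((\<lambda>t. artanh (t * norm \<zeta>)) has_field_derivative norm \<zeta> / (1 - (t * norm \<zeta>)\<^sup>2))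
                  (at t within {0..1})"
        by (rule DERIV_chain2[OF artanh_real_has_field_derivative, THEN DERIV_cong])
          (auto intro!: derivative_eq_intros)
      then show "((\<lambda>t. artanh (t * norm \<zeta>)) has_vector_derivative norm \<zeta> / (1 - (t * norm \<zeta>)\<^sup>2))
                  (at t within {0..1})"
        by (simp add: has_real_derivative_iff_has_vector_derivative)
    qed simp
    then have "((\<lambda>t. norm \<zeta> / (1 - (t * norm \<zeta>)\<^sup>2)) has_integral artanh (norm \<zeta>)) {0..1}"
      by simp
    moreover have "norm \<zeta> / (1 - (t * norm \<zeta>)\<^sup>2)
        = norm (vector_derivative \<gamma> (at t)) / (1 - (norm (\<gamma> t))\<^sup>2)" if t: "t \<in> {0..1}" for t
    proof -
      have "norm (vector_derivative \<gamma> (at t)) / (1 - (norm (\<gamma> t))\<^sup>2)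
          = norm \<zeta> * (norm (d t) / (1 - (norm (\<gamma> t))\<^sup>2))"
        by (simp add: vd[OF t] norm_mult)
      also have "norm (d t) / (1 - (norm (\<gamma> t))\<^sup>2) = 1 / (1 - (norm (of_real t * \<zeta>))\<^sup>2)"
        using moebius_pullback_of_metric[OF mz lt[OF t]] unfolding d_def \<gamma>_def .
      finally show ?thesis using t by (simp add: norm_mult)
    qed
    ultimately show "((\<lambda>t. norm (vector_derivative \<gamma> (at t)) / (1 - (norm (\<gamma> t))\<^sup>2))
        has_integral artanh (norm (disc_moebius z w))) {0..1}"
      unfolding \<zeta>_def[symmetric] by (rule has_integral_eq[rotated]) 
  qed
qed

theorem hyp_dist_eq_artanh:
  assumes "norm z < 1" "norm w < 1"
  shows "hyp_dist z w = artanh (norm (disc_moebius z w))"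
  unfolding hyp_dist_def
proof (rule cInf_eq_minimum)
  obtain \<gamma> where "valid_path \<gamma>" "path_image \<gamma> \<subseteq> unit_disc" "pathstart \<gamma> = z" "pathfinish \<gamma> = w"
    "((\<lambda>t. norm (vector_derivative \<gamma> (at t)) / (1 - (norm (\<gamma> t))\<^sup>2))
        has_integral artanh (norm (disc_moebius z w))) {0..1}"
    using hyperbolic_geodesic[OF assms] .
  then show "artanh (norm (disc_moebius z w)) \<in> {L. \<exists>\<gamma>. valid_path \<gamma> \<and> path_image \<gamma> \<subseteq> unit_disc \<and>
     pathstart \<gamma> = z \<and> pathfinish \<gamma> = w \<and>
     ((\<lambda>t. norm (vector_derivative \<gamma> (at t)) / (1 - (norm (\<gamma> t))\<^sup>2)) has_integral L) {0..1}}"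
    by blast
qed (use hyperbolic_length_ge_artanh in auto)

section \<open>The Schwarz--Pick lemma\<close>

text \<open>
  The Schwarz lemma, applied to \<open>f\<close> between automorphisms that move \<open>w\<close> and \<open>f w\<close> to \<open>0\<close>.
\<close>
lemma Schwarz_Pick:
  assumes f: "f holomorphic_on unit_disc" "f ` unit_disc \<subseteq> unit_disc"
    and z: "norm z < 1" and w: "norm w < 1"
  shows "norm (disc_moebius (f w) (f z)) \<le> norm (disc_moebius w z)"
proof -
  have fd: "norm (f x) < 1" if "norm x < 1" for x
    using f(2) that by (auto simp: image_subset_iff)
  have mw: "norm (-w) < 1" using w by simp
  define g where "g = disc_moebius (f w) \<circ> (f \<circ> disc_moebius (-w))"
  have "norm (g (disc_moebius w z)) \<le> norm (disc_moebius w z)"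
  proof (rule Schwarz_Lemma(1))
    have img: "disc_moebius (-w) ` unit_disc \<subseteq> unit_disc"
      using Moebius_function_norm_lt_1[OF mw] by auto
    have "(f \<circ> disc_moebius (-w)) holomorphic_on unit_disc"
      by (rule holomorphic_on_compose_gen[OF Moebius_function_holomorphic[OF mw] f(1) img])
    moreover have "(f \<circ> disc_moebius (-w)) ` unit_disc \<subseteq> unit_disc"
      using img f(2) by (force simp: image_subset_iff)
    ultimately show "g holomorphic_on unit_disc"
      unfolding g_def
      by (intro holomorphic_on_compose_gen[OF _ Moebius_function_holomorphic[OF fd[OF w]]])
    show "g 0 = 0"
      by (simp add: g_def Moebius_function_of_zero Moebius_function_eq_zero)
    show "norm (g x) < 1" if "norm x < 1" for x
      using Moebius_function_norm_lt_1[OF fd[OF w] fd[OF Moebius_function_norm_lt_1[OF mw that, of 0]]]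
      by (simp add: g_def)
  qed (rule Moebius_function_norm_lt_1[OF w z])
  moreover have "disc_moebius (-w) (disc_moebius w z) = z"
    by (rule Moebius_function_compose) (use mw z in auto)
  ultimately show ?thesis by (simp add: g_def)
qed

section \<open>The right half-plane model\<close>

text \<open>
  The conformal map of the disc onto the right half-plane that sends the boundary point \<open>\<tau>\<close> to
  infinity.  Its real part is the Poisson kernel at \<open>\<tau>\<close>, whose superlevel sets are the horodiscs at
  \<open>\<tau>\<close>.
\<close>
definition cayley :: "complex \<Rightarrow> complex \<Rightarrow> complex" where
  "cayley \<tau> z = (\<tau> + z) / (\<tau> - z)"

text \<open>
  The pseudo-hyperbolic distance of the right half-plane, that is, the hyperbolic tangent of the
  hyperbolic distance.
\<close>
definition pseudohyp :: "complex \<Rightarrow> complex \<Rightarrow> real" where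
  "pseudohyp a b = norm (a - b) / norm (a + cnj b)"

lemma Re_cayley:
  assumes "norm \<tau> = 1" "z \<noteq> \<tau>"
  shows "Re (cayley \<tau> z) = (1 - (norm z)\<^sup>2) / (norm (\<tau> - z))\<^sup>2"
proof -
  have "Re (cayley \<tau> z) = Re ((\<tau> + z) * cnj (\<tau> - z)) / (norm (\<tau> - z))\<^sup>2"
    unfolding cayley_def by (subst complex_div_cnj) (simp add: Re_divide_of_real flip: of_real_power)
  also have "Re ((\<tau> + z) * cnj (\<tau> - z)) = (norm \<tau>)\<^sup>2 - (norm z)\<^sup>2"
    unfolding cmod_power2 by (simp add: power2_eq_square algebra_simps)
  finally show ?thesis using assms by simp
qed

lemma Re_cayley_pos:
  assumes "norm \<tau> = 1" "norm z < 1"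
  shows "Re (cayley \<tau> z) > 0"
proof -
  have "z \<noteq> \<tau>" "(norm z)\<^sup>2 < 1" using assms by (auto simp: abs_square_less_1)
  then show ?thesis using assms by (simp add: Re_cayley)
qed

lemma cayley_plus_one: "z \<noteq> \<tau> \<Longrightarrow> cayley \<tau> z + 1 = 2 * \<tau> / (\<tau> - z)"
  by (simp add: cayley_def field_simps)

lemma cayley_holomorphic:
  assumes "norm \<tau> = 1"
  shows "cayley \<tau> holomorphic_on unit_disc"
  unfolding cayley_def using assms by (intro holomorphic_intros) auto

lemma norm_disc_moebius_eq_pseudohyp_cayley:
  assumes \<tau>: "norm \<tau> = 1" and z: "norm z < 1" and w: "norm w < 1"
  shows "norm (disc_moebius w z) = pseudohyp (cayley \<tau> z) (cayley \<tau> w)"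
proof -
  have nz: "\<tau> - z \<noteq> 0" "\<tau> - w \<noteq> 0" "\<tau> \<noteq> 0" using assms by auto
  have \<tau>1: "\<tau> * cnj \<tau> = 1" using \<tau> by (simp add: complex_norm_square[symmetric])
  then have nz': "1 - \<tau> * cnj w = \<tau> * cnj (\<tau> - w)" by (simp add: algebra_simps)
  then have nz'': "1 - \<tau> * cnj w \<noteq> 0" using nz by (metis complex_cnj_zero_iff mult_eq_0_iff)
  have cw: "cnj (cayley \<tau> w) = (1 + \<tau> * cnj w) / (1 - \<tau> * cnj w)"
  proof -
    have "(1 + \<tau> * cnj w) / (1 - \<tau> * cnj w) = (\<tau> * cnj (\<tau> + w)) / (\<tau> * cnj (\<tau> - w))"
      using nz' \<tau>1 by (simp add: algebra_simps)
    then show ?thesis using nz by (simp add: cayley_def)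
  qed
  have "cayley \<tau> z - cayley \<tau> w = 2 * \<tau> * (z - w) / ((\<tau> - z) * (\<tau> - w))"
    using nz by (simp add: cayley_def divide_simps) (simp add: algebra_simps)
  then have n1: "norm (cayley \<tau> z - cayley \<tau> w) = 2 * norm (z - w) / (norm (\<tau> - z) * norm (\<tau> - w))"
    using \<tau> by (simp add: norm_mult norm_divide)
  have "cayley \<tau> z + cnj (cayley \<tau> w) = 2 * \<tau> * (1 - cnj w * z) / ((\<tau> - z) * (1 - \<tau> * cnj w))"
    unfolding cw using nz nz'' by (simp add: cayley_def divide_simps) (simp add: algebra_simps)
  moreover have "norm (1 - \<tau> * cnj w) = norm (\<tau> - w)"
    using nz' \<tau> by (metis complex_mod_cnj mult_1 norm_mult)
  ultimately have n2: "norm (cayley \<tau> z + cnj (cayley \<tau> w)) =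
      2 * norm (1 - cnj w * z) / (norm (\<tau> - z) * norm (\<tau> - w))"
    using \<tau> by (simp add: norm_mult norm_divide)
  show ?thesis
    unfolding pseudohyp_def n1 n2 Moebius_function_simple using nz by (simp add: norm_divide)
qed

text \<open>
  Compose with the inverse Cayley transform for the boundary point \<open>1\<close> and use the version for the
  disc.
\<close>
lemma Schwarz_Pick_half_plane:
  assumes g: "g holomorphic_on unit_disc" "\<And>z. norm z < 1 \<Longrightarrow> Re (g z) > 0"
    and z: "norm z < 1" and w: "norm w < 1"
  shows "pseudohyp (g z) (g w) \<le> norm (disc_moebius w z)"
proof -
  define h where "h x = (g x - 1) / (g x + 1)" for x
  have nz: "g x + 1 \<noteq> 0" if "norm x < 1" for x
  proof
    assume "g x + 1 = 0"
    then have "Re (g x + 1) = 0" by simp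
    then show False using g(2)[OF that] by simp
  qed
  have lt: "norm (h x) < 1" if "norm x < 1" for x
  proof -
    have "(norm (g x - 1))\<^sup>2 < (norm (g x + 1))\<^sup>2"
      using g(2)[OF that] unfolding cmod_power2 by (simp add: power2_eq_square algebra_simps)
    then show ?thesis
      using nz[OF that] by (simp add: h_def norm_divide power2_less_imp_less)
  qed
  have ch: "cayley 1 (h x) = g x" if "norm x < 1" for x
    using nz[OF that] unfolding cayley_def h_def by (simp add: divide_simps)
  have "norm (disc_moebius (h w) (h z)) \<le> norm (disc_moebius w z)"
  proof (rule Schwarz_Pick[OF _ _ z w])
    show "h holomorphic_on unit_disc"
      unfolding h_def using nz by (intro holomorphic_intros g(1)) auto
    show "h ` unit_disc \<subseteq> unit_disc" using lt by auto
  qed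
  then show ?thesis
    by (simp add: norm_disc_moebius_eq_pseudohyp_cayley[of 1] lt z w ch)
qed

section \<open>The Denjoy--Wolff theorem\<close>

text \<open>
  Wolff's lemma.  For \<open>r < 1\<close> the map \<open>r f\<close> sends a closed disc of radius \<open>r\<close> into itself and has a
  fixed point there.  By Schwarz--Pick, \<open>r f\<close> does not increase the pseudo-hyperbolic distance to this
  fixed point.  As \<open>r\<close> tends to \<open>1\<close>, the fixed points accumulate at some \<open>\<tau>\<close>, which cannot lie inside
  the disc because \<open>f\<close> would fix it; the invariant discs around the fixed points become invariant
  horodiscs at \<open>\<tau>\<close>.
\<close>
lemma Wolff_boundary_point:
  assumes f: "f holomorphic_on unit_disc" "f ` unit_disc \<subseteq> unit_disc"
    and nofix: "\<forall>z\<in>unit_disc. f z \<noteq> z"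
  obtains \<tau> where "norm \<tau> = 1"
    "\<And>z. norm z < 1 \<Longrightarrow> Re (cayley \<tau> z) \<le> Re (cayley \<tau> (f z))"
proof -
  have fd: "norm (f x) < 1" if "norm x < 1" for x
    using f(2) that by (auto simp: image_subset_iff)
  have contf: "continuous_on unit_disc f"
    using f(1) by (rule holomorphic_on_imp_continuous_on)
  define r where "r k = 1 - 1 / real (k + 2)" for k
  have r: "0 < r k" "r k < 1" for k by (auto simp: r_def field_simps)
  have "\<exists>a. norm a \<le> r k \<and> r k * f a = a" for k
  proof -
    have sub: "cball 0 (r k) \<subseteq> (unit_disc :: complex set)" using r[of k] by auto
    obtain a where "a \<in> cball 0 (r k)" "r k * f a = a"
    proof (rule brouwer_ball[OF r(1)])
      show "continuous_on (cball 0 (r k)) (\<lambda>x. r k * f x)"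
        by (intro continuous_intros continuous_on_subset[OF contf sub])
      show "(\<lambda>x. r k * f x) \<in> cball 0 (r k) \<rightarrow> cball 0 (r k)"
      proof
        fix x :: complex assume "x \<in> cball 0 (r k)"
        then have "norm (f x) \<le> 1" using fd[of x] r[of k] by simp
        then show "r k * f x \<in> cball 0 (r k)" 
          using r[of k] by (simp add: norm_mult mult_left_le)
      qed
    qed auto
    then show ?thesis by auto
  qed
  then obtain a where a: "\<And>k. norm (a k) \<le> r k" "\<And>k. r k * f (a k) = a k" by metis
  have a1: "norm (a k) < 1" for k using a(1)[of k] r(2)[of k] by simp
  \<comment> \<open>Schwarz--Pick at the fixed point, cleared of the common factor \<open>1 - |a k|\<^sup>2\<close>, which would
     degenerate in the limit.\<close>
  have SP: "(1 - (norm z)\<^sup>2) * (norm (1 - cnj (a k) * (r k * f z)))\<^sup>2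
      \<le> (1 - (norm (r k * f z))\<^sup>2) * (norm (1 - cnj (a k) * z))\<^sup>2" if z: "norm z < 1" for z k
  proof -
    have rd: "norm (r k * f x) < 1" if "norm x < 1" for x
      using fd[OF that] r[of k] by (simp add: norm_mult) (smt (verit) mult_less_cancel_left1 norm_ge_zero mult_le_cancel_left1)
    have "norm (disc_moebius (r k * f (a k)) (r k * f z)) \<le> norm (disc_moebius (a k) z)"
      using rd by (intro Schwarz_Pick[OF _ _ z a1] holomorphic_intros f(1)) auto
    then have "(norm (disc_moebius (a k) (r k * f z)))\<^sup>2 \<le> (norm (disc_moebius (a k) z))\<^sup>2"
      unfolding a(2) by (rule power_mono) simp
    then have "1 - (norm (disc_moebius (a k) z))\<^sup>2 \<le> 1 - (norm (disc_moebius (a k) (r k * f z)))\<^sup>2"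
      by simp
    then show ?thesis
      unfolding one_minus_norm_moebius_sq[OF a1 z] one_minus_norm_moebius_sq[OF a1 rd[OF z]]
      using one_minus_cnj_mult_nonzero[OF a1 z] one_minus_cnj_mult_nonzero[OF a1 rd[OF z]] a1[of k]
      by (simp add: divide_simps abs_square_less_1 mult_le_cancel_left_pos mult.assoc)
  qed
  have "\<forall>k. a k \<in> cball 0 1" using a1 by (simp add: less_imp_le)
  then obtain \<tau> s where \<tau>: "\<tau> \<in> cball 0 1" and s: "strict_mono s" and lim: "(a \<circ> s) \<longlonglongrightarrow> \<tau>"
    using compact_cball[of "0::complex" 1] unfolding compact_def by blast
  have "(\<lambda>k. 1 - 1 / real (k + 2)) \<longlonglongrightarrow> 1 - 0"
    by (intro tendsto_intros LIMSEQ_ignore_initial_segment[OF lim_1_over_n])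
  then have "r \<longlonglongrightarrow> 1" by (simp add: r_def[abs_def])
  then have rlim: "(\<lambda>k. complex_of_real (r (s k))) \<longlonglongrightarrow> 1"
    using LIMSEQ_subseq_LIMSEQ[OF _ s] tendsto_of_real by (fastforce simp: o_def)
  have alim: "(\<lambda>k. a (s k)) \<longlonglongrightarrow> \<tau>" using lim by (simp add: o_def)
  have \<tau>1: "norm \<tau> = 1"
  proof (rule ccontr)
    assume "norm \<tau> \<noteq> 1"
    then have \<tau>d: "\<tau> \<in> unit_disc" using \<tau> by simp
    have "(\<lambda>k. f (a (s k))) \<longlonglongrightarrow> f \<tau>"
      by (rule continuous_on_tendsto_compose[OF contf alim \<tau>d]) (use a1 in simp)
    from tendsto_mult[OF rlim this] have "(\<lambda>k. a (s k)) \<longlonglongrightarrow> f \<tau>"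
      by (simp add: a(2))
    then have "f \<tau> = \<tau>" using alim LIMSEQ_unique by blast
    then show False using nofix \<tau>d by blast
  qed
  show ?thesis
  proof (rule that[OF \<tau>1])
    fix z :: complex assume z: "norm z < 1"
    have "(\<lambda>k. (1 - (norm z)\<^sup>2) * (norm (1 - cnj (a (s k)) * (r (s k) * f z)))\<^sup>2)
        \<longlonglongrightarrow> (1 - (norm z)\<^sup>2) * (norm (1 - cnj \<tau> * (1 * f z)))\<^sup>2"
      by (intro tendsto_intros alim rlim)
    moreover have "(\<lambda>k. (1 - (norm (r (s k) * f z))\<^sup>2) * (norm (1 - cnj (a (s k)) * z))\<^sup>2)
        \<longlonglongrightarrow> (1 - (norm (1 * f z))\<^sup>2) * (norm (1 - cnj \<tau> * z))\<^sup>2"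
      by (intro tendsto_intros alim rlim)
    ultimately have "(1 - (norm z)\<^sup>2) * (norm (1 - cnj \<tau> * (1 * f z)))\<^sup>2
        \<le> (1 - (norm (1 * f z))\<^sup>2) * (norm (1 - cnj \<tau> * z))\<^sup>2"
      by (rule LIMSEQ_le) (use SP[OF z] in blast)
    moreover have "norm (1 - cnj \<tau> * x) = norm (\<tau> - x)" for x
    proof -
      have "\<tau> * cnj \<tau> = 1" using \<tau>1 by (simp add: complex_norm_square[symmetric])
      then have "\<tau> * (1 - cnj \<tau> * x) = \<tau> - x" by (simp add: algebra_simps)
      then show ?thesis using \<tau>1 by (metis mult_1 norm_mult)
    qed
    ultimately show "Re (cayley \<tau> z) \<le> Re (cayley \<tau> (f z))"
      using z fd[OF z] \<tau>1 by (subst (1 2) Re_cayley) (auto simp: divide_simps)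
  qed
qed

lemma funpow_in_disc:
  assumes "f ` unit_disc \<subseteq> unit_disc" "norm z < 1"
  shows "norm ((f ^^ n) z) < 1"
  using assms by (induction n) (auto simp: image_subset_iff)

text \<open>
  The maximum principle for \<open>1 / (1 + g - g l)\<close>: its modulus is at most \<open>1\<close>, with equality at \<open>l\<close>.
\<close>
lemma holomorphic_Re_nonneg_attains_zero:
  assumes g: "g holomorphic_on unit_disc" "\<And>z. norm z < 1 \<Longrightarrow> Re (g z) \<ge> 0"
    and l: "norm l < 1" "Re (g l) = 0" and z: "norm z < 1"
  shows "g z = g l"
proof -
  define h where "h x = 1 / (1 + g x - g l)" for x
  have ge1: "norm (1 + g x - g l) \<ge> 1" if "norm x < 1" for x
    using g(2)[OF that] l(2) complex_Re_le_cmod[of "1 + g x - g l"] by simp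
  have "h constant_on unit_disc"
  proof (rule maximum_modulus_principle[where U = unit_disc and \<xi> = l])
    show "h holomorphic_on unit_disc"
      unfolding h_def using ge1 by (intro holomorphic_intros g(1)) force
  qed (use ge1 l in \<open>auto simp: h_def norm_divide divide_simps\<close>)
  then have "h z = h l" using z l by (auto simp: constant_on_def)
  then show ?thesis using ge1[OF z] by (auto simp: h_def divide_simps split: if_splits)
qed

text \<open>
  Along an orbit the real part in the half-plane is nondecreasing and hence bounded away from \<open>0\<close>, so
  a limit point \<open>l\<close> of the orbit other than \<open>\<tau>\<close> lies inside the disc.  By continuity the real part does
  not grow from \<open>l\<close> to \<open>f l\<close>.  The maximum principle makes \<open>f\<close> a vertical translation of the
  half-plane, by a nonzero amount as \<open>l\<close> is not fixed, and then the orbit tends to infinity there.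
\<close>
lemma Denjoy_Wolff_convergence:
  assumes f: "f holomorphic_on unit_disc" "f ` unit_disc \<subseteq> unit_disc"
    and nofix: "\<forall>z\<in>unit_disc. f z \<noteq> z"
    and \<tau>: "norm \<tau> = 1"
    and Wolff: "\<And>z. norm z < 1 \<Longrightarrow> Re (cayley \<tau> z) \<le> Re (cayley \<tau> (f z))"
    and z: "norm z < 1"
  shows "(\<lambda>n. (f ^^ n) z) \<longlonglongrightarrow> \<tau>"
proof (rule ccontr)
  define u where "u n = (f ^^ n) z" for n
  have fd: "norm (f x) < 1" if "norm x < 1" for x
    using f(2) that by (auto simp: image_subset_iff)
  have ud: "norm (u n) < 1" for n unfolding u_def by (rule funpow_in_disc[OF f(2) z])
  have uSuc: "u (Suc n) = f (u n)" for n by (simp add: u_def)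
  have mono: "incseq (\<lambda>n. Re (cayley \<tau> (u n)))"
    by (rule incseq_SucI) (use Wolff[OF ud] in \<open>simp add: uSuc\<close>)
  assume "\<not> (\<lambda>n. (f ^^ n) z) \<longlonglongrightarrow> \<tau>"
  then have "\<not> u \<longlonglongrightarrow> \<tau>" by (simp add: u_def[abs_def])
  then obtain \<epsilon> where \<epsilon>: "\<epsilon> > 0" "\<exists>\<^sub>F n in sequentially. dist (u n) \<tau> \<ge> \<epsilon>"
    unfolding tendsto_iff frequently_def by (auto simp: not_le)
  have inf: "infinite {n. dist (u n) \<tau> \<ge> \<epsilon>}"
    using \<epsilon>(2) by (simp only: frequently_cofinite[symmetric] cofinite_eq_sequentially)
  obtain s :: "nat \<Rightarrow> nat" where s: "strict_mono s" "\<And>n. dist (u (s n)) \<tau> \<ge> \<epsilon>"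
    using infinite_enumerate[OF inf] by auto
  have "\<forall>k. (u \<circ> s) k \<in> cball 0 1" using ud by (simp add: less_imp_le)
  then obtain l s' where l: "l \<in> cball 0 1" and s': "strict_mono s'" and lim: "((u \<circ> s) \<circ> s') \<longlonglongrightarrow> l"
    using compact_cball[of "0::complex" 1] unfolding compact_def by metis
  define t where "t = s \<circ> s'"
  have t: "strict_mono t" unfolding t_def by (rule strict_mono_o[OF s(1) s'])
  have ulim: "(\<lambda>k. u (t k)) \<longlonglongrightarrow> l" using lim by (simp add: o_def t_def)
  have "l \<noteq> \<tau>"
  proof -
    have "\<epsilon> \<le> dist l \<tau>"
      by (rule LIMSEQ_le_const[OF tendsto_dist[OF ulim tendsto_const]]) (use s(2) in \<open>auto simp: t_def\<close>)
    then show ?thesis using \<epsilon>(1) by auto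
  qed
  then have Clim: "(\<lambda>k. cayley \<tau> (u (t k))) \<longlonglongrightarrow> cayley \<tau> l"
    unfolding cayley_def by (intro tendsto_intros ulim) auto
  then have Xlim: "(\<lambda>k. Re (cayley \<tau> (u (t k)))) \<longlonglongrightarrow> Re (cayley \<tau> l)"
    by (rule tendsto_Re)
  have "Re (cayley \<tau> (u 0)) \<le> Re (cayley \<tau> l)"
    by (rule LIMSEQ_le_const[OF Xlim]) (use mono in \<open>auto simp: incseq_def\<close>)
  then have "Re (cayley \<tau> l) > 0"
    using Re_cayley_pos[OF \<tau> ud[of 0]] by linarith
  then have ld: "norm l < 1"
    using l \<open>l \<noteq> \<tau>\<close> Re_cayley[OF \<tau> \<open>l \<noteq> \<tau>\<close>] by (cases "norm l = 1") auto
  have flim: "(\<lambda>k. u (Suc (t k))) \<longlonglongrightarrow> f l"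
    unfolding uSuc
    by (rule continuous_on_tendsto_compose[OF holomorphic_on_imp_continuous_on[OF f(1)] ulim])
      (use ud ld in auto)
  have "f l \<noteq> \<tau>" using fd[OF ld] \<tau> by auto
  then have Cflim: "(\<lambda>k. cayley \<tau> (u (Suc (t k)))) \<longlonglongrightarrow> cayley \<tau> (f l)"
    unfolding cayley_def by (intro tendsto_intros flim) auto
  have "Re (cayley \<tau> (f l)) \<le> Re (cayley \<tau> l)"
  proof (rule LIMSEQ_le[OF tendsto_Re[OF Cflim] LIMSEQ_Suc[OF Xlim]], intro exI allI impI)
    fix k
    have "Suc (t k) \<le> t (Suc k)" using t by (simp add: strict_mono_Suc_iff Suc_le_eq)
    then show "Re (cayley \<tau> (u (Suc (t k)))) \<le> Re (cayley \<tau> (u (t (Suc k))))"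
      using mono by (simp add: incseq_def)
  qed
  with Wolff[OF ld] have Re0: "Re (cayley \<tau> (f l) - cayley \<tau> l) = 0" by simp
  define c where "c = cayley \<tau> (f l) - cayley \<tau> l"
  have step: "cayley \<tau> (f x) - cayley \<tau> x = c" if "norm x < 1" for x
    unfolding c_def
  proof (rule holomorphic_Re_nonneg_attains_zero
      [where g = "\<lambda>x. cayley \<tau> (f x) - cayley \<tau> x", OF _ _ ld Re0 that])
    have "cayley \<tau> \<circ> f holomorphic_on unit_disc"
      by (rule holomorphic_on_compose_gen[OF f(1) cayley_holomorphic[OF \<tau>] f(2)])
    then show "(\<lambda>x. cayley \<tau> (f x) - cayley \<tau> x) holomorphic_on unit_disc"
      using cayley_holomorphic[OF \<tau>] by (intro holomorphic_intros) (simp add: o_def)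
  qed (use Wolff in simp)
  have lin: "cayley \<tau> (u n) = cayley \<tau> (u 0) + of_nat n * c" for n
  proof (induction n)
    case (Suc n)
    then show ?case using step[OF ud[of n]] by (simp add: uSuc algebra_simps)
  qed simp
  have "c = 0"
  proof (rule ccontr)
    assume "c \<noteq> 0"
    have quot: "(cayley \<tau> (u n) - cayley \<tau> (u 0)) / c = of_nat n" for n
      using \<open>c \<noteq> 0\<close> lin[of n] by simp
    have "(\<lambda>k. (cayley \<tau> (u (t k)) - cayley \<tau> (u 0)) / c) \<longlonglongrightarrow> (cayley \<tau> l - cayley \<tau> (u 0)) / c"
      using \<open>c \<noteq> 0\<close> by (intro tendsto_intros Clim)
    then have "(\<lambda>k. of_nat (t k) :: complex) \<longlonglongrightarrow> (cayley \<tau> l - cayley \<tau> (u 0)) / c"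
      by (simp only: quot)
    then have "convergent (\<lambda>k. of_nat (t k) :: complex)" by (rule convergentI)
    then have "Bseq (\<lambda>k. of_nat (t k) :: complex)" by (rule convergent_imp_Bseq)
    then obtain K where K: "\<And>k. norm (of_nat (t k) :: complex) \<le> K"
      by (elim BseqE) auto
    have "real k \<le> K" for k
    proof -
      have "real k \<le> real (t k)" using strict_mono_imp_increasing[OF t, of k] by simp
      with K[of k] show ?thesis by (simp add: norm_of_nat)
    qed
    then show False using reals_Archimedean2[of K] by (metis not_le)
  qed
  then have eq: "cayley \<tau> (f l) = cayley \<tau> l" by (simp add: c_def)
  have "f l = l"
    using eq \<open>l \<noteq> \<tau>\<close> \<open>f l \<noteq> \<tau>\<close> cayley_plus_one[of l \<tau>] cayley_plus_one[of "f l" \<tau>] \<tau> by auto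
  then show False using nofix ld by simp
qed

lemma denjoy_wolff_point_eqI:
  assumes "norm \<tau> = 1" "\<And>z. norm z < 1 \<Longrightarrow> (\<lambda>n. (f ^^ n) z) \<longlonglongrightarrow> \<tau>"
  shows "denjoy_wolff_point f = \<tau>"
  unfolding denjoy_wolff_point_def
proof (rule the_equality)
  fix \<sigma> assume "\<sigma> \<in> sphere 0 1 \<and> (\<forall>z\<in>unit_disc. (\<lambda>n. (f ^^ n) z) \<longlonglongrightarrow> \<sigma>)"
  then have "(\<lambda>n. (f ^^ n) 0) \<longlonglongrightarrow> \<sigma>" by auto
  with assms(2)[of 0] show "\<sigma> = \<tau>" using LIMSEQ_unique by auto
qed (use assms in auto)

section \<open>Hyperbolic distance in half-plane coordinates\<close>

lemma norm_plus_cnj_le: "norm (a + cnj b) \<le> norm (a - b) + 2 * \<bar>Re b\<bar>"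
proof -
  have "a - b + of_real (2 * Re b) = a + cnj b"
    by (simp add: complex_eq_iff)
  then show ?thesis
    using norm_triangle_ineq[of "a - b" "of_real (2 * Re b)"] by (simp only: norm_of_real abs_mult abs_numeral)
qed

lemma pseudohyp_commute: "pseudohyp a b = pseudohyp b a"
proof -
  have "norm (a + cnj b) = norm (b + cnj a)"
    by (metis add.commute complex_cnj_add complex_cnj_cnj complex_mod_cnj)
  then show ?thesis by (simp add: pseudohyp_def norm_minus_commute)
qed

lemma norm_plus_cnj_sq: "(norm (a + cnj b))\<^sup>2 - (norm (a - b))\<^sup>2 = 4 * Re a * Re b"
  unfolding cmod_power2 by (simp add: power2_eq_square algebra_simps)

lemma norm_diff_less_norm_plus_cnj:
  assumes "Re a > 0" "Re b > 0"
  shows "norm (a - b) < norm (a + cnj b)"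
  using norm_plus_cnj_sq[of a b] assms
  by (smt (verit) mult_pos_pos norm_ge_zero power_mono)

lemma pseudohyp_less_1:
  assumes "Re a > 0" "Re b > 0"
  shows "pseudohyp a b < 1"
  using norm_diff_less_norm_plus_cnj[OF assms]
  by (simp add: pseudohyp_def divide_less_eq)

text \<open>
  The exponential of twice the hyperbolic distance.  It is bounded below by the
  Euclidean quantity \<open>1 + |a - b| / Re b\<close>, and above by its square if \<open>Re b \<le> Re a\<close>.
\<close>
definition exp_double_dist :: "complex \<Rightarrow> complex \<Rightarrow> real" where
  "exp_double_dist a b = (1 + pseudohyp a b) / (1 - pseudohyp a b)"

lemma exp_double_dist_commute: "exp_double_dist a b = exp_double_dist b a"
  by (simp add: exp_double_dist_def pseudohyp_commute)

lemma artanh_pseudohyp: "artanh (pseudohyp a b) = ln (exp_double_dist a b) / 2"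
  by (simp add: artanh_def exp_double_dist_def)

lemma one_plus_div_one_minus_mono:
  fixes r s :: real
  assumes "r \<le> s" "s < 1"
  shows "(1 + r) / (1 - r) \<le> (1 + s) / (1 - s)"
  using assms by (simp add: divide_simps algebra_simps)

lemma exp_double_dist_eq:
  assumes "Re a > 0" "Re b > 0"
  shows "exp_double_dist a b = (norm (a + cnj b) + norm (a - b))\<^sup>2 / (4 * Re a * Re b)"
proof -
  define p q where "p = norm (a + cnj b)" and "q = norm (a - b)"
  have pq: "q < p" "q \<ge> 0" using norm_diff_less_norm_plus_cnj[OF assms] by (auto simp: p_def q_def)
  then have "exp_double_dist a b = (p + q) / (p - q)"
    by (simp add: exp_double_dist_def pseudohyp_def p_def[symmetric] q_def[symmetric] field_simps)
  also have "\<dots> = (p + q)\<^sup>2 / ((p - q) * (p + q))"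
    using pq by (simp add: power2_eq_square)
  also have "(p - q) * (p + q) = 4 * Re a * Re b"
    using norm_plus_cnj_sq[of a b] by (simp add: p_def q_def power2_eq_square algebra_simps)
  finally show ?thesis by (simp add: p_def q_def)
qed

lemma exp_double_dist_ge:
  assumes "Re a > 0" "Re b > 0"
  shows "1 + norm (a - b) / Re b \<le> exp_double_dist a b"
proof -
  define p q where "p = norm (a + cnj b)" and "q = norm (a - b)"
  have pq: "q < p" "q \<ge> 0" using norm_diff_less_norm_plus_cnj[OF assms] by (auto simp: p_def q_def)
  then have "exp_double_dist a b = 1 + 2 * q / (p - q)"
    by (simp add: exp_double_dist_def pseudohyp_def p_def[symmetric] q_def[symmetric] field_simps)
  moreover have "p - q \<le> 2 * Re b" using norm_plus_cnj_le[of a b] assms by (simp add: p_def q_def)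
  then have "2 * q / (2 * Re b) \<le> 2 * q / (p - q)"
    using pq by (intro divide_left_mono) (auto intro: mult_pos_pos assms)
  ultimately show ?thesis by (simp add: q_def)
qed

lemma exp_double_dist_le:
  assumes "Re a > 0" "Re a \<le> Re b"
  shows "exp_double_dist a b \<le> (1 + norm (b - a) / Re a)\<^sup>2"
proof -
  have b: "Re b > 0" using assms by linarith
  have "norm (a + cnj b) + norm (a - b) \<le> 2 * (norm (b - a) + Re a)"
    using norm_plus_cnj_le[of b a] assms(1)
      complex_mod_cnj[of "a + cnj b"] by (simp add: norm_minus_commute add.commute)
  then have "(norm (a + cnj b) + norm (a - b))\<^sup>2 \<le> (2 * (norm (b - a) + Re a))\<^sup>2"
    by (intro power_mono) auto
  moreover have "4 * Re a * Re a \<le> 4 * Re a * Re b" using assms by simp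
  ultimately have "exp_double_dist a b \<le> (2 * (norm (b - a) + Re a))\<^sup>2 / (4 * Re a * Re a)"
    unfolding exp_double_dist_eq[OF assms(1) b] using assms(1)
    by (intro frac_le) auto
  also have "\<dots> = (1 + norm (b - a) / Re a)\<^sup>2"
    using assms(1) by (simp add: power2_eq_square field_simps)
  finally show ?thesis .
qed

text \<open>
  The only estimate of the hyperbolic distance that the comparison of orbits needs: up to a factor
  \<open>2\<close>, it is the logarithm of \<open>1 + |b - a| / Re a\<close>, where \<open>a\<close> is the point closer to the boundary.
\<close>
lemma artanh_pseudohyp_bounds:
  assumes "Re a > 0" "Re a \<le> Re b"
  shows "ln (1 + norm (b - a) / Re a) / 2 \<le> artanh (pseudohyp a b)"
    and "artanh (pseudohyp a b) \<le> ln (1 + norm (b - a) / Re a)"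
proof -
  have b: "Re b > 0" using assms by linarith
  define t where "t = 1 + norm (b - a) / Re a"
  have t: "t \<ge> 1" using assms(1) by (simp add: t_def)
  have lo: "t \<le> exp_double_dist a b"
    using exp_double_dist_ge[OF b assms(1)] by (simp add: t_def exp_double_dist_commute)
  have up: "exp_double_dist a b \<le> t\<^sup>2" using exp_double_dist_le[OF assms] by (simp add: t_def)
  have "ln t \<le> ln (exp_double_dist a b)" using lo t by simp
  moreover have "ln (exp_double_dist a b) \<le> ln (t\<^sup>2)" using lo up t by simp
  then have "ln (exp_double_dist a b) \<le> 2 * ln t" using t by (simp add: ln_realpow)
  ultimately show "ln (1 + norm (b - a) / Re a) / 2 \<le> artanh (pseudohyp a b)"
    "artanh (pseudohyp a b) \<le> ln (1 + norm (b - a) / Re a)"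
    unfolding artanh_pseudohyp t_def[symmetric] by simp_all
qed

section \<open>Quasi-geodesic sequences stay in a sector\<close>

lemma linear_le_ln_imp_bounded:
  fixes e A B :: real
  assumes "e > 0" "A > 0"
  obtains T where "T \<ge> 0" "\<And>t. t \<ge> 0 \<Longrightarrow> e * t \<le> A * ln (1 + t) + B \<Longrightarrow> t \<le> T"
proof -
  define \<eta> where "\<eta> = e / (2 * A)"
  have \<eta>: "\<eta> > 0" "A * \<eta> = e / 2" using assms by (auto simp: \<eta>_def)
  define T where "T = max 0 (2 / e * (e / 2 + B - A * ln \<eta>))"
  show ?thesis
  proof (rule that)
    fix t :: real assume t: "t \<ge> 0" and le: "e * t \<le> A * ln (1 + t) + B"
    have "ln (\<eta> * (1 + t)) \<le> \<eta> * (1 + t) - 1" using \<eta> t by (intro ln_le_minus_one) simp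
    then have "ln (1 + t) \<le> \<eta> * (1 + t) - ln \<eta>" using \<eta> t by (simp add: ln_mult)
    then have "A * ln (1 + t) \<le> A * (\<eta> * (1 + t) - ln \<eta>)"
      using assms(2) by (intro mult_left_mono) auto
    also have "\<dots> = e / 2 * (1 + t) - A * ln \<eta>"
      unfolding right_diff_distrib mult.assoc[symmetric] \<eta>(2) ..
    finally have "e / 2 * t \<le> e / 2 + B - A * ln \<eta>" using le by (simp add: algebra_simps)
    then have "2 / e * (e / 2 * t) \<le> 2 / e * (e / 2 + B - A * ln \<eta>)"
      using assms(1) by (intro mult_left_mono) auto
    then have "t \<le> 2 / e * (e / 2 + B - A * ln \<eta>)" using assms(1) by simp
    then show "t \<le> T" by (simp add: T_def)
  qed (simp add: T_def)
qed

lemma norm_diff_le_sum_steps: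
  fixes w :: "nat \<Rightarrow> complex"
  assumes "n \<le> m"
  shows "norm (w m - w n) \<le> (\<Sum>k=n..<m. norm (w (Suc k) - w k))"
  using norm_sum[of "\<lambda>k. w (Suc k) - w k" "{n..<m}"] by (simp add: sum_Suc_diff' assms)

text \<open>
  While \<open>Re w\<close> at most doubles, the sum of the hyperbolic step lengths is at least a constant times
  the Euclidean displacement \<open>t\<close> measured in units of \<open>Re (w n)\<close>, whereas the hyperbolic distance of
  its ends is at most \<open>ln (1 + t)\<close>.  The quasi-geodesic inequality therefore bounds \<open>t\<close>.
\<close>
lemma quasi_geodesic_short_range:
  fixes w :: "nat \<Rightarrow> complex"
  assumes pos: "\<And>n. Re (w n) > 0" and mono: "incseq (\<lambda>n. Re (w n))"
    and c: "\<And>n. norm (w (Suc n) - w n) \<le> c * Re (w n)"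
    and A: "A > 0"
    and qg: "\<And>n m. n < m \<Longrightarrow> (\<Sum>k=n..<m. artanh (pseudohyp (w k) (w (Suc k))))
                \<le> A * artanh (pseudohyp (w n) (w m)) + B"
  obtains T where "T \<ge> 0"
    "\<And>n m. n \<le> m \<Longrightarrow> Re (w m) \<le> 2 * Re (w n) \<Longrightarrow> norm (w m - w n) \<le> T * Re (w n)"
proof -
  have c0: "c \<ge> 0" using c[of 0] pos[of 0] by (smt (verit) norm_ge_zero zero_le_mult_iff)
  define e where "e = 1 / (4 * (1 + c))"
  have e: "e > 0" using c0 by (simp add: e_def)
  obtain T where T: "T \<ge> 0" "\<And>t. t \<ge> 0 \<Longrightarrow> e * t \<le> A * ln (1 + t) + B \<Longrightarrow> t \<le> T"
    using linear_le_ln_imp_bounded[OF e A, of B] by blast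
  show ?thesis
  proof (rule that[OF T(1)])
    fix n m :: nat assume "n \<le> m" and two: "Re (w m) \<le> 2 * Re (w n)"
    show "norm (w m - w n) \<le> T * Re (w n)"
    proof (cases "n = m")
      case True then show ?thesis using T(1) pos[of n] by simp
    next
      case False
      then have nm: "n < m" using \<open>n \<le> m\<close> by simp
      have xle: "Re (w i) \<le> Re (w j)" if "i \<le> j" for i j using mono that by (simp add: incseq_def)
      define t where "t = norm (w m - w n) / Re (w n)"
      have t0: "t \<ge> 0" using pos[of n] by (simp add: t_def)
      have step: "e / Re (w n) * norm (w (Suc k) - w k) \<le> artanh (pseudohyp (w k) (w (Suc k)))"
        if k: "k \<in> {n..<m}" for k
      proof -
        define s where "s = norm (w (Suc k) - w k) / Re (w k)"
        have s: "s \<ge> 0" "s \<le> c" using pos[of k] c[of k] by (auto simp: s_def divide_le_eq)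
        have "Re (w k) \<le> 2 * Re (w n)" using xle[of k m] two k by auto
        then have "norm (w (Suc k) - w k) / (2 * Re (w n)) \<le> s"
          unfolding s_def using pos[of k] pos[of n] by (intro divide_left_mono) auto
        then have "norm (w (Suc k) - w k) / (2 * Re (w n)) / (2 * (1 + c)) \<le> s / (2 * (1 + c))"
          using c0 by (intro divide_right_mono) auto
        then have "e / Re (w n) * norm (w (Suc k) - w k) \<le> s / (2 * (1 + c))"
          by (simp add: e_def mult_ac)
        also have "\<dots> \<le> s / (2 * (1 + s))"
          using s c0 by (intro divide_left_mono) auto
        also have "\<dots> \<le> ln (1 + s) / 2"
        proof -
          have "ln (1 / (1 + s)) \<le> 1 / (1 + s) - 1" using s by (intro ln_le_minus_one) auto
          also have "\<dots> = - (s / (1 + s))" using s by (simp add: field_simps)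
          finally have "s / (1 + s) \<le> ln (1 + s)" using s by (simp add: ln_div)
          from divide_right_mono[OF this, of 2] show ?thesis
            unfolding divide_divide_eq_left mult.commute[of 2] by simp
        qed
        also have "\<dots> \<le> artanh (pseudohyp (w k) (w (Suc k)))"
          unfolding s_def by (rule artanh_pseudohyp_bounds(1)[OF pos xle]) simp
        finally show ?thesis .
      qed
      have "e * t = e / Re (w n) * norm (w m - w n)" by (simp add: t_def)
      also have "\<dots> \<le> e / Re (w n) * (\<Sum>k=n..<m. norm (w (Suc k) - w k))"
        using norm_diff_le_sum_steps[OF \<open>n \<le> m\<close>] e pos[of n] by (intro mult_left_mono) auto
      also have "\<dots> \<le> (\<Sum>k=n..<m. artanh (pseudohyp (w k) (w (Suc k))))"
        unfolding sum_distrib_left by (rule sum_mono) (rule step)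
      also have "\<dots> \<le> A * artanh (pseudohyp (w n) (w m)) + B" by (rule qg[OF nm])
      also have "\<dots> \<le> A * ln (1 + t) + B"
        using artanh_pseudohyp_bounds(2)[OF pos xle[OF \<open>n \<le> m\<close>]] A by (simp add: t_def)
      finally have "t \<le> T" by (rule T(2)[OF t0])
      then show ?thesis using pos[of n] by (simp add: t_def divide_le_eq)
    qed
  qed
qed

text \<open>
  Induction over the doublings of \<open>Re w\<close>: the displacement since the last time that \<open>Re w\<close> was below
  half of its present value is a bounded multiple of \<open>Re w\<close>, and the earlier displacement is bounded
  by induction with half the bound, as in a geometric series.
\<close>
lemma quasi_geodesic_imp_sector:
  fixes w :: "nat \<Rightarrow> complex"
  assumes pos: "\<And>n. Re (w n) > 0" and mono: "incseq (\<lambda>n. Re (w n))"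
    and c: "\<And>n. norm (w (Suc n) - w n) \<le> c * Re (w n)"
    and A: "A > 0"
    and qg: "\<And>n m. n < m \<Longrightarrow> (\<Sum>k=n..<m. artanh (pseudohyp (w k) (w (Suc k))))
                \<le> A * artanh (pseudohyp (w n) (w m)) + B"
  obtains K where "\<And>n. norm (w n - w 0) \<le> K * Re (w n)"
proof -
  have c0: "c \<ge> 0" using c[of 0] pos[of 0] by (smt (verit) norm_ge_zero zero_le_mult_iff)
  obtain T where T: "T \<ge> 0"
    "\<And>n m. n \<le> m \<Longrightarrow> Re (w m) \<le> 2 * Re (w n) \<Longrightarrow> norm (w m - w n) \<le> T * Re (w n)"
    using quasi_geodesic_short_range[OF pos mono c A qg] by blast
  have xle: "Re (w i) \<le> Re (w j)" if "i \<le> j" for i j using mono that by (simp add: incseq_def)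
  define K where "K = c + 2 * T"
  have K: "K \<ge> 0" using c0 T(1) by (simp add: K_def)
  have "norm (w m - w 0) \<le> K * Re (w m)" for m
  proof (induction m rule: less_induct)
    case (less m)
    \<comment> \<open>The first time from which on \<open>Re w\<close> is at least half of its value at time \<open>m\<close>.\<close>
    define n where "n = (LEAST n. Re (w m) \<le> 2 * Re (w n))"
    have ex: "Re (w m) \<le> 2 * Re (w m)" using pos[of m] by simp
    have n: "Re (w m) \<le> 2 * Re (w n)" and nm: "n \<le> m"
      unfolding n_def using ex by (rule LeastI, rule Least_le)
    have short: "norm (w m - w n) \<le> T * Re (w m)"
      using T(2)[OF nm n] mult_left_mono[OF xle[OF nm] T(1)] by linarith
    show ?case
    proof (cases n)
      case 0
      have "T * Re (w m) \<le> K * Re (w m)"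
        using pos[of m] c0 T(1) by (intro mult_right_mono) (auto simp: K_def)
      then show ?thesis using short 0 by simp
    next
      case (Suc j)
      then have "\<not> Re (w m) \<le> 2 * Re (w j)"
        using not_less_Least[of j "\<lambda>n. Re (w m) \<le> 2 * Re (w n)"] by (simp add: n_def)
      then have half: "Re (w j) \<le> Re (w m) / 2" by simp
      have "norm (w j - w 0) \<le> K * Re (w j)" using less.IH[of j] nm Suc by simp
      also have "\<dots> \<le> K * (Re (w m) / 2)" by (rule mult_left_mono[OF half K])
      finally have 1: "norm (w j - w 0) \<le> K * (Re (w m) / 2)" .
      have 2: "norm (w n - w j) \<le> c * (Re (w m) / 2)"
        using c[of j] mult_left_mono[OF half c0] Suc by simp
      have "norm (w m - w 0) \<le> norm (w m - w n) + norm (w n - w j) + norm (w j - w 0)"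
        using norm_triangle_ineq[of "w m - w n" "w n - w j"]
          norm_triangle_ineq[of "w m - w j" "w j - w 0"] by simp
      also have "\<dots> \<le> T * Re (w m) + c * (Re (w m) / 2) + K * (Re (w m) / 2)"
        using short 1 2 by simp
      also have "\<dots> = K * Re (w m)" by (simp add: K_def field_simps)
      finally show ?thesis .
    qed
  qed
  then show ?thesis by (rule that)
qed

section \<open>Orbits in a sector are quasi-geodesic\<close>

text \<open>
  Think of \<open>p n\<close> as the value at \<open>w n\<close> of a holomorphic self-map of the half-plane, which does not
  increase hyperbolic distance.  In a sector, as long as \<open>Re w\<close> has not doubled since time \<open>n\<close>, the
  orbit stays within bounded hyperbolic distance of \<open>w n\<close>, hence \<open>p\<close> differs from \<open>p n\<close> by at most
  \<open>K * Re (p n)\<close>.  If \<open>p n\<close> were nearly vertical, all these steps would be nearly parallel to it, and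
  the orbit would move vertically much more than horizontally until \<open>Re w\<close> has doubled, so that it
  would leave the sector.
\<close>
lemma sector_orbit_steps_in_sector:
  fixes w :: "nat \<Rightarrow> complex"
  defines "p n \<equiv> w (Suc n) - w n"
  assumes pos: "\<And>n. Re (w n) > 0" and ppos: "\<And>n. Re (p n) > 0"
    and c: "\<And>n. norm (p n) \<le> c * Re (w n)"
    and contr: "\<And>k n. pseudohyp (p k) (p n) \<le> pseudohyp (w k) (w n)"
    and R: "\<And>n. norm (w n) \<le> R * Re (w n)"
    and unbdd: "\<And>y. \<exists>m. y < Re (w m)"
  obtains M where "M \<ge> 0" "\<And>n. norm (p n) \<le> M * Re (p n)"
proof -
  have c0: "c \<ge> 0" using c[of 0] pos[of 0] by (smt (verit) norm_ge_zero zero_le_mult_iff)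
  have R0: "R \<ge> 0" using R[of 0] pos[of 0] by (smt (verit) norm_ge_zero zero_le_mult_iff)
  have "incseq (\<lambda>n. Re (w n))"
    by (rule incseq_SucI) (use ppos in \<open>simp add: p_def less_imp_le\<close>)
  then have xle: "Re (w i) \<le> Re (w j)" if "i \<le> j" for i j using that by (simp add: incseq_def)
  \<comment> \<open>Points of the sector whose real parts lie between \<open>x\<close> and \<open>2 x\<close> are at Euclidean distance at
     most \<open>R * 2 x + R * x = 3 * R * x\<close>.\<close>
  define K where "K = (1 + 3 * R)\<^sup>2"
  have K0: "K \<ge> 0" by (simp add: K_def)
  define M where "M = 2 * K + 8 * R * (1 + c) * (K + 1)"
  have M2: "8 * R * (1 + c) * (K + 1) \<ge> 0" using R0 c0 K0 by simp
  have close: "norm (p k - p n) \<le> K * Re (p n)" if k: "n \<le> k" "Re (w k) \<le> 2 * Re (w n)" for n k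
  proof -
    have "norm (w k - w n) \<le> norm (w k) + norm (w n)" by (rule norm_triangle_ineq4)
    also have "\<dots> \<le> R * Re (w k) + R * Re (w n)" using R[of k] R[of n] by simp
    also have "\<dots> \<le> R * (2 * Re (w n)) + R * Re (w n)"
      using mult_left_mono[OF k(2) R0] by simp
    finally have "norm (w k - w n) / Re (w n) \<le> 3 * R"
      using pos[of n] by (simp add: divide_le_eq algebra_simps)
    then have "(1 + norm (w k - w n) / Re (w n))\<^sup>2 \<le> K"
      unfolding K_def using pos[of n] by (intro power_mono) auto
    then have "exp_double_dist (w k) (w n) \<le> K"
      using exp_double_dist_le[OF pos xle[OF k(1)]] exp_double_dist_commute[of "w k" "w n"] by linarith
    moreover have "exp_double_dist (p k) (p n) \<le> exp_double_dist (w k) (w n)"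
      unfolding exp_double_dist_def
      by (rule one_plus_div_one_minus_mono[OF contr pseudohyp_less_1[OF pos pos]])
    ultimately have "norm (p k - p n) / Re (p n) \<le> K"
      using exp_double_dist_ge[OF ppos ppos, of k n] by linarith
    then show ?thesis using ppos[of n] by (simp add: divide_le_eq)
  qed
  have "norm (p n) \<le> M * Re (p n)" for n
  proof (cases "norm (p n) \<le> 2 * K * Re (p n)")
    case True
    have "2 * K * Re (p n) \<le> M * Re (p n)"
      using M2 ppos[of n] by (intro mult_right_mono) (auto simp: M_def)
    with True show ?thesis by linarith
  next
    case False
    \<comment> \<open>The first time at which \<open>Re w\<close> has more than doubled; up to then \<open>close\<close> controls the steps.\<close>
    define m where "m = (LEAST m. 2 * Re (w n) < Re (w m))"
    have m: "2 * Re (w n) < Re (w m)"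
      unfolding m_def using unbdd by (rule LeastI_ex)
    have before: "Re (w k) \<le> 2 * Re (w n)" if "k < m" for k
      using not_less_Least[of k "\<lambda>m. 2 * Re (w n) < Re (w m)"] that by (simp add: m_def)
    have nm: "n < m"
    proof (rule ccontr)
      assume "\<not> n < m"
      then have "Re (w m) \<le> Re (w n)" by (intro xle) simp
      then show False using m pos[of n] by linarith
    qed
    define N where "N = real (m - n)"
    have N: "N > 0" using nm by (simp add: N_def)
    have tele: "w m - w n = (\<Sum>k=n..<m. p k)"
      using nm by (simp add: p_def sum_Suc_diff')
    have "norm (w m - w n - of_real N * p n) = norm (\<Sum>k=n..<m. p k - p n)"
      using nm by (simp add: tele sum_subtractf N_def)
    also have "\<dots> \<le> (\<Sum>k=n..<m. K * Re (p n))"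
      by (rule sum_norm_le) (use close before in auto)
    also have "\<dots> = N * (K * Re (p n))" using nm by (simp add: N_def)
    finally have dev: "norm (w m - w n - of_real N * p n) \<le> N * (K * Re (p n))" .
    have "norm (of_real N * p n) \<le> norm (w m - w n) + norm (w m - w n - of_real N * p n)"
      using norm_triangle_ineq4[of "w m - w n" "w m - w n - of_real N * p n"] by simp
    with dev have "N * norm (p n) \<le> norm (w m - w n) + N * (K * Re (p n))"
      using N by (simp add: norm_mult)
    moreover have "N * (2 * K * Re (p n)) \<le> N * norm (p n)"
      using False N by (intro mult_left_mono) auto
    ultimately have 1: "N * norm (p n) \<le> 2 * norm (w m - w n)" by linarith
    have "norm (w m - w n) \<le> norm (w m) + norm (w n)" by (rule norm_triangle_ineq4)
    also have "\<dots> \<le> R * Re (w m) + R * Re (w m)"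
      using R[of m] R[of n] mult_left_mono[OF xle[of n m] R0] nm by linarith
    also have "\<dots> = 2 * R * Re (w m)" by simp
    also have "\<dots> \<le> 2 * R * ((1 + c) * (2 * Re (w n)))"
    proof (rule mult_left_mono)
      obtain j where j: "m = Suc j" using nm by (cases m) auto
      have "Re (p j) \<le> c * Re (w j)" using c[of j] complex_Re_le_cmod[of "p j"] by linarith
      then have "Re (w m) \<le> (1 + c) * Re (w j)" by (simp add: p_def j algebra_simps)
      also have "\<dots> \<le> (1 + c) * (2 * Re (w n))"
        using before[of j] c0 j by (intro mult_left_mono) auto
      finally show "Re (w m) \<le> (1 + c) * (2 * Re (w n))" .
    qed (use R0 in simp)
    finally have 2: "norm (w m - w n) \<le> 4 * R * (1 + c) * Re (w n)" by (simp add: mult_ac)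
    have "Re (w n) \<le> Re (w m - w n)" using m by simp
    also have "\<dots> = Re (w m - w n - of_real N * p n) + N * Re (p n)" by simp
    also have "\<dots> \<le> N * (K * Re (p n)) + N * Re (p n)"
      using dev complex_Re_le_cmod[of "w m - w n - of_real N * p n"] by linarith
    finally have 3: "Re (w n) \<le> N * ((K + 1) * Re (p n))" by (simp add: algebra_simps)
    have "N * norm (p n) \<le> 8 * R * (1 + c) * Re (w n)" using 1 2 by linarith
    also have "\<dots> \<le> 8 * R * (1 + c) * (N * ((K + 1) * Re (p n)))"
      using 3 R0 c0 by (intro mult_left_mono) auto
    finally have "N * norm (p n) \<le> N * (8 * R * (1 + c) * (K + 1) * Re (p n))"
      by (simp add: mult_ac)
    then have "norm (p n) \<le> 8 * R * (1 + c) * (K + 1) * Re (p n)" using N by simp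
    also have "\<dots> \<le> M * Re (p n)"
      using K0 ppos[of n] by (intro mult_right_mono) (auto simp: M_def)
    finally show ?thesis .
  qed
  moreover have "M \<ge> 0" using K0 M2 by (simp add: M_def)
  ultimately show ?thesis using that by blast
qed

text \<open>
  If the steps themselves lie in a sector, each hyperbolic step length is at most a constant times the
  increment of \<open>ln (Re w)\<close>.  These increments telescope, and \<open>ln (Re (w m) / Re (w n))\<close> is at most
  twice the hyperbolic distance of \<open>w n\<close> and \<open>w m\<close>.
\<close>
lemma steps_in_sector_imp_quasi_geodesic:
  fixes w :: "nat \<Rightarrow> complex"
  assumes pos: "\<And>n. Re (w n) > 0" and mono: "incseq (\<lambda>n. Re (w n))"
    and c: "\<And>n. norm (w (Suc n) - w n) \<le> c * Re (w n)"
    and M: "M \<ge> 0" "\<And>n. norm (w (Suc n) - w n) \<le> M * Re (w (Suc n) - w n)"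
    and nm: "n \<le> m"
  shows "(\<Sum>k=n..<m. artanh (pseudohyp (w k) (w (Suc k))))
           \<le> 2 * M * (1 + c) * artanh (pseudohyp (w n) (w m))"
proof -
  have c0: "c \<ge> 0" using c[of 0] pos[of 0] by (smt (verit) norm_ge_zero zero_le_mult_iff)
  have xle: "Re (w i) \<le> Re (w j)" if "i \<le> j" for i j using mono that by (simp add: incseq_def)
  have step: "artanh (pseudohyp (w k) (w (Suc k))) \<le> M * (1 + c) * (ln (Re (w (Suc k))) - ln (Re (w k)))" for k
  proof -
    define x y where "x = Re (w k)" and "y = Re (w (Suc k))"
    have xy: "x > 0" "x \<le> y" "y > 0" using pos xle[of k "Suc k"] by (auto simp: x_def y_def)
    have "y - x \<le> c * x"
      using c[of k] complex_Re_le_cmod[of "w (Suc k) - w k"] by (simp add: x_def y_def)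
    then have yle: "y \<le> (1 + c) * x" by (simp add: algebra_simps)
    have "artanh (pseudohyp (w k) (w (Suc k))) \<le> ln (1 + norm (w (Suc k) - w k) / x)"
      unfolding x_def by (rule artanh_pseudohyp_bounds(2)[OF pos xle]) simp
    also have "\<dots> \<le> norm (w (Suc k) - w k) / x"
      using xy by (intro ln_add_one_self_le_self) simp
    also have "\<dots> \<le> M * (y - x) / x"
      using M(2)[of k] xy by (intro divide_right_mono) (auto simp: x_def y_def)
    also have "\<dots> = M * ((y - x) / x)" by simp
    also have "\<dots> \<le> M * ((1 + c) * (ln y - ln x))"
    proof (rule mult_left_mono[OF _ M(1)])
      have "ln (x / y) \<le> x / y - 1" using xy by (intro ln_le_minus_one) simp
      then have "(y - x) / y \<le> ln y - ln x" using xy by (simp add: ln_div field_simps)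
      then have "(1 + c) * ((y - x) / y) \<le> (1 + c) * (ln y - ln x)"
        using c0 by (intro mult_left_mono) auto
      moreover have "(y - x) / x \<le> (1 + c) * ((y - x) / y)"
      proof -
        have "(y - x) * y \<le> (y - x) * ((1 + c) * x)" using yle xy by (intro mult_left_mono) auto
        then show ?thesis using xy by (simp add: field_simps)
      qed
      ultimately show "(y - x) / x \<le> (1 + c) * (ln y - ln x)" by linarith
    qed
    finally show ?thesis by (simp add: x_def y_def mult_ac)
  qed
  have "(\<Sum>k=n..<m. artanh (pseudohyp (w k) (w (Suc k))))
      \<le> (\<Sum>k=n..<m. M * (1 + c) * (ln (Re (w (Suc k))) - ln (Re (w k))))"
    by (rule sum_mono) (rule step)
  also have "\<dots> = M * (1 + c) * (ln (Re (w m)) - ln (Re (w n)))"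
    using nm by (simp add: sum_distrib_left[symmetric] sum_Suc_diff'[where f = "\<lambda>k. ln (Re (w k))"])
  also have "\<dots> \<le> M * (1 + c) * (2 * artanh (pseudohyp (w n) (w m)))"
  proof (rule mult_left_mono)
    have "Re (w m) - Re (w n) \<le> norm (w m - w n)"
      using complex_Re_le_cmod[of "w m - w n"] by simp
    then have "(Re (w m) - Re (w n)) / Re (w n) \<le> norm (w m - w n) / Re (w n)"
      using pos[of n] by (intro divide_right_mono) auto
    then have "Re (w m) / Re (w n) \<le> 1 + norm (w m - w n) / Re (w n)"
      using pos[of n] by (simp add: diff_divide_distrib)
    then have "ln (Re (w m) / Re (w n)) \<le> ln (1 + norm (w m - w n) / Re (w n))"
      using pos[of n] pos[of m] by (subst ln_le_cancel_iff) (auto intro: add_pos_nonneg)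
    then show "ln (Re (w m)) - ln (Re (w n)) \<le> 2 * artanh (pseudohyp (w n) (w m))"
      using artanh_pseudohyp_bounds(1)[OF pos xle[OF nm]] pos[of n] pos[of m] by (simp add: ln_div)
  qed (use M c0 in simp)
  finally show ?thesis by (simp only: mult_ac)
qed

section \<open>Non-tangential convergence in half-plane coordinates\<close>

text \<open>
  Since \<open>cayley \<tau> z + 1 = 2 \<tau> / (\<tau> - z)\<close> and \<open>Re (cayley \<tau> z) = (1 - |z|\<^sup>2) / |\<tau> - z|\<^sup>2\<close>, the ratio
  \<open>|cayley \<tau> z + 1| / Re (cayley \<tau> z)\<close> equals \<open>2 |\<tau> - z| / (1 - |z|\<^sup>2)\<close>, which is
  \<open>|\<tau> - z| / (1 - |z|)\<close> up to a factor between \<open>1\<close> and \<open>2\<close>.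
\<close>
lemma converges_nontangentially_iff_sector:
  assumes \<tau>: "norm \<tau> = 1" and u: "\<And>n. norm (u n) < 1" "u \<longlonglongrightarrow> \<tau>"
  shows "converges_nontangentially u \<tau>
           \<longleftrightarrow> (\<exists>K. \<forall>n. norm (cayley \<tau> (u n) + 1) \<le> K * Re (cayley \<tau> (u n)))"
proof -
  have ne: "u n \<noteq> \<tau>" for n using u(1)[of n] \<tau> by auto
  have N: "norm (cayley \<tau> (u n) + 1) = 2 / norm (\<tau> - u n)" for n
    using \<tau> by (simp add: cayley_plus_one[OF ne] norm_divide norm_mult)
  have X: "Re (cayley \<tau> (u n)) = (1 - norm (u n)) * (1 + norm (u n)) / (norm (\<tau> - u n))\<^sup>2" for n
    by (simp add: Re_cayley[OF \<tau> ne] power2_eq_square algebra_simps)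
  show ?thesis
  proof
    assume "converges_nontangentially u \<tau>"
    then obtain R where R: "\<And>n. norm (\<tau> - u n) < R * (1 - norm (u n))" "R > 1"
      unfolding converges_nontangentially_def by blast
    have "norm (cayley \<tau> (u n) + 1) \<le> (2 * R) * Re (cayley \<tau> (u n))" for n
    proof -
      define d where "d = norm (\<tau> - u n)"
      have d: "d > 0" using ne[of n] by (auto simp: d_def)
      have "R * (1 - norm (u n)) \<le> R * (1 - norm (u n)) * (1 + norm (u n))"
        using R(2) u(1)[of n] mult_left_mono[of 1 "1 + norm (u n)" "R * (1 - norm (u n))"] by simp
      then have "d \<le> R * (1 - norm (u n)) * (1 + norm (u n))"
        using R(1)[of n] by (simp add: d_def)
      then have "2 * d / d\<^sup>2 \<le> 2 * (R * (1 - norm (u n)) * (1 + norm (u n))) / d\<^sup>2"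
        by (intro divide_right_mono) auto
      then show ?thesis using d unfolding N X d_def[symmetric]
        by (simp add: power2_eq_square mult.assoc)
    qed
    then show "\<exists>K. \<forall>n. norm (cayley \<tau> (u n) + 1) \<le> K * Re (cayley \<tau> (u n))" by blast
  next
    assume "\<exists>K. \<forall>n. norm (cayley \<tau> (u n) + 1) \<le> K * Re (cayley \<tau> (u n))"
    then obtain K where K: "\<And>n. norm (cayley \<tau> (u n) + 1) \<le> K * Re (cayley \<tau> (u n))" by blast
    have "norm (\<tau> - u n) < (\<bar>K\<bar> + 2) * (1 - norm (u n))" for n
    proof -
      define d where "d = norm (\<tau> - u n)"
      have d: "d > 0" using ne[of n] by (auto simp: d_def)
      define v where "v = 1 - norm (u n)"
      have v: "v > 0" using u(1)[of n] by (simp add: v_def)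
      have "2 / d \<le> K * (v * (1 + norm (u n)) / d\<^sup>2)"
        using K[of n] unfolding N X d_def[symmetric] v_def[symmetric] .
      then have "d\<^sup>2 * (2 / d) \<le> d\<^sup>2 * (K * (v * (1 + norm (u n)) / d\<^sup>2))"
        by (intro mult_left_mono) auto
      then have "2 * d \<le> K * (v * (1 + norm (u n)))" using d by (simp add: power2_eq_square)
      also have "\<dots> \<le> \<bar>K\<bar> * (v * 2)"
        using v u(1)[of n] by (intro mult_mono) auto
      finally have "d \<le> \<bar>K\<bar> * v" by simp
      then show ?thesis using v by (simp add: d_def v_def[symmetric] algebra_simps)
    qed
    then show "converges_nontangentially u \<tau>"
      unfolding converges_nontangentially_def using \<tau> u
      by (intro conjI exI[of _ "\<bar>K\<bar> + 2"]) auto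
  qed
qed

section \<open>Orbits in half-plane coordinates\<close>

text \<open>
  The last assumption is the conclusion of Wolff's lemma: horodiscs at \<open>\<tau>\<close> are mapped into themselves.
\<close>
locale disc_map_with_wolff_point =
  fixes f :: "complex \<Rightarrow> complex" and \<tau> :: complex
  assumes hol: "f holomorphic_on unit_disc"
    and self_map: "f ` unit_disc \<subseteq> unit_disc"
    and \<tau>: "norm \<tau> = 1"
    and Wolff: "\<And>z. norm z < 1 \<Longrightarrow> Re (cayley \<tau> z) \<le> Re (cayley \<tau> (f z))"
begin

definition hp_orbit :: "complex \<Rightarrow> nat \<Rightarrow> complex" where
  "hp_orbit z n = cayley \<tau> ((f ^^ n) z)"

lemma orbit_in_disc: "norm z < 1 \<Longrightarrow> norm ((f ^^ n) z) < 1"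
  by (rule funpow_in_disc[OF self_map])

lemma Re_hp_orbit_pos: "norm z < 1 \<Longrightarrow> Re (hp_orbit z n) > 0"
  unfolding hp_orbit_def by (rule Re_cayley_pos[OF \<tau> orbit_in_disc])

lemma incseq_Re_hp_orbit: "norm z < 1 \<Longrightarrow> incseq (\<lambda>n. Re (hp_orbit z n))"
  by (rule incseq_SucI) (use Wolff orbit_in_disc in \<open>simp add: hp_orbit_def\<close>)

lemma hyp_dist_orbit:
  assumes "norm z < 1"
  shows "hyp_dist ((f ^^ n) z) ((f ^^ m) z) = artanh (pseudohyp (hp_orbit z n) (hp_orbit z m))"
  unfolding hp_orbit_def
  by (simp add: hyp_dist_eq_artanh norm_disc_moebius_eq_pseudohyp_cayley[OF \<tau>] pseudohyp_commute
      orbit_in_disc assms)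

lemma pseudohyp_orbits_le:
  assumes z: "norm z < 1" and z': "norm z' < 1"
  shows "pseudohyp (hp_orbit z n) (hp_orbit z' n) \<le> pseudohyp (hp_orbit z 0) (hp_orbit z' 0)"
proof (induction n)
  case (Suc n)
  have "norm (f ((f ^^ n) z)) < 1" "norm (f ((f ^^ n) z')) < 1"
    using orbit_in_disc[of _ "Suc n"] z z' by auto
  then have "pseudohyp (hp_orbit z (Suc n)) (hp_orbit z' (Suc n)) \<le> pseudohyp (hp_orbit z n) (hp_orbit z' n)"
    using Schwarz_Pick[OF hol self_map orbit_in_disc[OF z, of n] orbit_in_disc[OF z', of n]]
    by (simp add: hp_orbit_def norm_disc_moebius_eq_pseudohyp_cayley[OF \<tau>] orbit_in_disc z z')
  with Suc show ?case by simp
qed simp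

lemma norm_hp_orbits_diff_le:
  assumes z: "norm z < 1" and z': "norm z' < 1"
  shows "norm (hp_orbit z n - hp_orbit z' n)
          \<le> (exp_double_dist (hp_orbit z 0) (hp_orbit z' 0) - 1) * Re (hp_orbit z' n)"
proof -
  note pos = Re_hp_orbit_pos[OF z] and pos' = Re_hp_orbit_pos[OF z']
  have "exp_double_dist (hp_orbit z n) (hp_orbit z' n) \<le> exp_double_dist (hp_orbit z 0) (hp_orbit z' 0)"
    unfolding exp_double_dist_def
    by (rule one_plus_div_one_minus_mono[OF pseudohyp_orbits_le[OF z z'] pseudohyp_less_1[OF pos pos']])
  then have "norm (hp_orbit z n - hp_orbit z' n) / Re (hp_orbit z' n)
      \<le> exp_double_dist (hp_orbit z 0) (hp_orbit z' 0) - 1"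
    using exp_double_dist_ge[OF pos pos', of n n] by linarith
  then show ?thesis using pos' by (simp add: divide_le_eq)
qed

text \<open>The orbits of \<open>f z\<close> and \<open>z\<close> are compared: an orbit moves by bounded hyperbolic steps.\<close>
lemma norm_hp_orbit_step_le:
  assumes z: "norm z < 1"
  shows "norm (hp_orbit z (Suc n) - hp_orbit z n)
          \<le> (exp_double_dist (hp_orbit z 1) (hp_orbit z 0) - 1) * Re (hp_orbit z n)"
proof -
  have "norm (f z) < 1" using orbit_in_disc[OF z, of 1] by simp
  from norm_hp_orbits_diff_le[OF this z, of n] show ?thesis
    by (simp add: hp_orbit_def funpow_swap1)
qed

text \<open>
  Two orbits stay at bounded hyperbolic distance from each other, so non-tangential convergence of
  one of them carries over to the other.
\<close>
lemma sector_transfer: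
  assumes z0: "norm z0 < 1" and z: "norm z < 1"
    and K: "\<And>n. norm (hp_orbit z0 n + 1) \<le> K * Re (hp_orbit z0 n)"
  obtains R where "\<And>n. norm (hp_orbit z n + 1) \<le> R * Re (hp_orbit z n)"
proof
  fix n
  define E where "E = exp_double_dist (hp_orbit z0 0) (hp_orbit z 0)"
  have K0: "K \<ge> 0"
    using K[of 0] Re_hp_orbit_pos[OF z0, of 0] by (smt (verit) norm_ge_zero zero_le_mult_iff)
  have near: "norm (hp_orbit z0 n - hp_orbit z n) \<le> (E - 1) * Re (hp_orbit z n)"
    using norm_hp_orbits_diff_le[OF z0 z, of n] by (simp add: E_def)
  then have "Re (hp_orbit z0 n) \<le> E * Re (hp_orbit z n)"
    using complex_Re_le_cmod[of "hp_orbit z0 n - hp_orbit z n"] by (simp add: left_diff_distrib)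
  then have "norm (hp_orbit z0 n + 1) \<le> K * (E * Re (hp_orbit z n))"
    using K[of n] mult_left_mono[OF _ K0] by (meson order_trans)
  moreover have "norm (hp_orbit z n + 1)
      \<le> norm (hp_orbit z0 n + 1) + norm (hp_orbit z0 n - hp_orbit z n)"
    using norm_triangle_ineq4[of "hp_orbit z0 n + 1" "hp_orbit z0 n - hp_orbit z n"]
    by (simp add: add.commute)
  ultimately show "norm (hp_orbit z n + 1) \<le>
      (K * exp_double_dist (hp_orbit z0 0) (hp_orbit z 0) + exp_double_dist (hp_orbit z0 0) (hp_orbit z 0))
        * Re (hp_orbit z n)"
    using near Re_hp_orbit_pos[OF z, of n] by (simp add: E_def[symmetric] algebra_simps)
qed

lemma Re_hp_orbit_unbounded:
  assumes z: "norm z < 1" and lim: "(\<lambda>n. (f ^^ n) z) \<longlonglongrightarrow> \<tau>"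
    and R: "\<And>n. norm (hp_orbit z n + 1) \<le> R * Re (hp_orbit z n)"
  shows "\<exists>m. y < Re (hp_orbit z m)"
proof -
  have "0 < Re (hp_orbit z 0 + 1)" using Re_hp_orbit_pos[OF z, of 0] by simp
  also have "\<dots> \<le> R * Re (hp_orbit z 0)" using R complex_Re_le_cmod order_trans by blast
  finally have R0: "R > 0" using Re_hp_orbit_pos[OF z, of 0] by (simp add: zero_less_mult_iff)
  define \<epsilon> where "\<epsilon> = 2 / (R * (\<bar>y\<bar> + 1))"
  have \<epsilon>: "\<epsilon> > 0" using R0 by (simp add: \<epsilon>_def)
  obtain m where m: "norm ((f ^^ m) z - \<tau>) < \<epsilon>"
    using LIMSEQ_D[OF lim \<epsilon>] by blast
  have ne: "(f ^^ m) z \<noteq> \<tau>" using orbit_in_disc[OF z, of m] \<tau> by auto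
  have "R * (\<bar>y\<bar> + 1) = 2 / \<epsilon>" using R0 by (simp add: \<epsilon>_def)
  also have "\<dots> \<le> 2 / norm (\<tau> - (f ^^ m) z)"
    using m ne \<epsilon> by (intro divide_left_mono) (auto simp: norm_minus_commute)
  also have "\<dots> = norm (hp_orbit z m + 1)"
    using \<tau> by (simp add: hp_orbit_def cayley_plus_one[OF ne] norm_divide norm_mult)
  also have "\<dots> \<le> R * Re (hp_orbit z m)" by (rule R)
  finally have "\<bar>y\<bar> + 1 \<le> Re (hp_orbit z m)" using R0 by simp
  then show ?thesis by (intro exI[of _ m]) linarith
qed

lemma step_function_holomorphic: "(\<lambda>x. cayley \<tau> (f x) - cayley \<tau> x) holomorphic_on unit_disc"
proof -
  have "cayley \<tau> \<circ> f holomorphic_on unit_disc"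
    by (rule holomorphic_on_compose_gen[OF hol cayley_holomorphic[OF \<tau>] self_map])
  then show ?thesis
    using cayley_holomorphic[OF \<tau>] by (intro holomorphic_intros) (simp add: o_def)
qed

text \<open>
  If the real part of the step vanished anywhere, the step would be an imaginary constant by the
  maximum principle, and the orbit could not leave its vertical line.
\<close>
lemma Re_step_pos:
  assumes z: "norm z < 1" and unbdd: "\<And>y. \<exists>m. y < Re (hp_orbit z m)" and x: "norm x < 1"
  shows "Re (cayley \<tau> (f x) - cayley \<tau> x) > 0"
proof (rule ccontr)
  define p where "p x = cayley \<tau> (f x) - cayley \<tau> x" for x
  have hol_p: "p holomorphic_on unit_disc"
    unfolding p_def[abs_def] by (rule step_function_holomorphic)
  have pnn: "Re (p x) \<ge> 0" if "norm x < 1" for x using Wolff[OF that] by (simp add: p_def)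
  assume "\<not> Re (cayley \<tau> (f x) - cayley \<tau> x) > 0"
  then have px0: "Re (p x) = 0" using pnn[OF x] by (simp add: p_def)
  have "Re (p y) = 0" if "norm y < 1" for y
    using holomorphic_Re_nonneg_attains_zero[OF hol_p pnn x px0 that] px0 by simp
  then have "Re (hp_orbit z (Suc n)) = Re (hp_orbit z n)" for n
    using orbit_in_disc[OF z, of n] by (simp add: p_def hp_orbit_def)
  then have "Re (hp_orbit z n) = Re (hp_orbit z 0)" for n by (induction n) auto
  then show False using unbdd[of "Re (hp_orbit z 0)"] by (metis less_irrefl)
qed

lemma sector_orbit_imp_quasi_geodesic:
  assumes z: "norm z < 1" and lim: "(\<lambda>n. (f ^^ n) z) \<longlonglongrightarrow> \<tau>"
    and R: "\<And>n. norm (hp_orbit z n + 1) \<le> R * Re (hp_orbit z n)"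
  obtains A where "A \<ge> 1"
    "\<And>n m. n < m \<Longrightarrow> (\<Sum>k=n..<m. hyp_dist ((f ^^ k) z) ((f ^^ (k + 1)) z))
                \<le> A * hyp_dist ((f ^^ n) z) ((f ^^ m) z)"
proof -
  define w where "w = hp_orbit z"
  define p where "p x = cayley \<tau> (f x) - cayley \<tau> x" for x
  define c where "c = exp_double_dist (w 1) (w 0) - 1"
  note pos = Re_hp_orbit_pos[OF z, folded w_def] and mono = incseq_Re_hp_orbit[OF z, folded w_def]
    and step = norm_hp_orbit_step_le[OF z, folded w_def, folded c_def]
    and unbdd = Re_hp_orbit_unbounded[OF z lim R, folded w_def]
  have pw: "w (Suc n) - w n = p ((f ^^ n) z)" for n by (simp add: p_def w_def hp_orbit_def)
  have hol_p: "p holomorphic_on unit_disc"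
    unfolding p_def[abs_def] by (rule step_function_holomorphic)
  have ppos: "Re (p x) > 0" if "norm x < 1" for x
    unfolding p_def by (rule Re_step_pos[OF z Re_hp_orbit_unbounded[OF z lim R] that])
  have R': "norm (w n) \<le> R * Re (w n)" for n
  proof -
    have "(norm (w n))\<^sup>2 \<le> (norm (w n + 1))\<^sup>2"
      using pos[of n] unfolding cmod_power2 by (simp add: power2_eq_square algebra_simps)
    then show ?thesis using R[of n] by (simp add: w_def power2_le_iff_abs_le)
  qed
  obtain M where M: "M \<ge> 0" "\<And>n. norm (w (Suc n) - w n) \<le> M * Re (w (Suc n) - w n)"
  proof (rule sector_orbit_steps_in_sector[of w, OF pos _ step _ R' unbdd])
    show "Re (w (Suc n) - w n) > 0" for n
      using ppos[OF orbit_in_disc[OF z]] by (simp only: pw)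
    \<comment> \<open>Here the step is a holomorphic function of the point, so Schwarz--Pick applies to it.\<close>
    show "pseudohyp (w (Suc k) - w k) (w (Suc n) - w n) \<le> pseudohyp (w k) (w n)" for k n
      using Schwarz_Pick_half_plane[OF hol_p ppos orbit_in_disc[OF z, of k] orbit_in_disc[OF z, of n]]
      unfolding pw
      by (simp only: norm_disc_moebius_eq_pseudohyp_cayley[OF \<tau> orbit_in_disc[OF z] orbit_in_disc[OF z]]
          w_def hp_orbit_def)
  qed blast
  define A where "A = max 1 (2 * M * (1 + c))"
  show ?thesis
  proof
    fix n m :: nat assume nm: "n < m"
    have le: "Re (w n) \<le> Re (w m)" using mono nm by (simp add: incseq_def)
    have "ln (1 + norm (w m - w n) / Re (w n)) \<ge> 0"
      using pos[of n] by (intro ln_ge_zero) simp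
    then have nn: "artanh (pseudohyp (w n) (w m)) \<ge> 0"
      using artanh_pseudohyp_bounds(1)[OF pos le] by linarith
    have "(\<Sum>k=n..<m. artanh (pseudohyp (w k) (w (Suc k))))
        \<le> 2 * M * (1 + c) * artanh (pseudohyp (w n) (w m))"
      using steps_in_sector_imp_quasi_geodesic[OF pos mono step M less_imp_le[OF nm]] .
    also have "\<dots> \<le> A * artanh (pseudohyp (w n) (w m))"
      using nn by (intro mult_right_mono) (auto simp: A_def)
    finally show "(\<Sum>k=n..<m. hyp_dist ((f ^^ k) z) ((f ^^ (k + 1)) z))
        \<le> A * hyp_dist ((f ^^ n) z) ((f ^^ m) z)"
      unfolding hyp_dist_orbit[OF z] w_def by simp
  qed (simp add: A_def)
qed

lemma quasi_geodesic_orbit_imp_sector: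
  assumes z: "norm z < 1" and A: "A > 0"
    and qg: "\<And>n m. n < m \<Longrightarrow> (\<Sum>k=n..<m. hyp_dist ((f ^^ k) z) ((f ^^ (k + 1)) z))
                \<le> A * hyp_dist ((f ^^ n) z) ((f ^^ m) z) + B"
  obtains K where "\<And>n. norm (hp_orbit z n + 1) \<le> K * Re (hp_orbit z n)"
proof -
  define w where "w = hp_orbit z"
  note pos = Re_hp_orbit_pos[OF z, folded w_def] and mono = incseq_Re_hp_orbit[OF z, folded w_def]
    and step = norm_hp_orbit_step_le[OF z, folded w_def]
  have "(\<Sum>k=n..<m. artanh (pseudohyp (w k) (w (Suc k)))) \<le> A * artanh (pseudohyp (w n) (w m)) + B"
    if "n < m" for n m
    using qg[OF that] unfolding hyp_dist_orbit[OF z] w_def by simp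
  then obtain K where K: "\<And>n. norm (w n - w 0) \<le> K * Re (w n)"
    using quasi_geodesic_imp_sector[OF pos mono step A] by blast
  show ?thesis
  proof
    fix n
    define L where "L = norm (w 0 + 1) / Re (w 0)"
    have "Re (w 0) \<le> Re (w n)" using mono by (simp add: incseq_def)
    then have "L * Re (w 0) \<le> L * Re (w n)"
      using pos[of 0] by (intro mult_left_mono) (auto simp: L_def)
    then have "norm (w 0 + 1) \<le> L * Re (w n)" using pos[of 0] by (simp add: L_def)
    moreover have "norm (w n + 1) \<le> norm (w n - w 0) + norm (w 0 + 1)"
      using norm_triangle_ineq[of "w n - w 0" "w 0 + 1"] by simp
    ultimately have "norm (w n + 1) \<le> (K + L) * Re (w n)"
      using K[of n] by (simp add: distrib_right)
    then show "norm (hp_orbit z n + 1)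
        \<le> (K + norm (w 0 + 1) / Re (w 0)) * Re (hp_orbit z n)"
      by (simp add: w_def L_def)
  qed
qed

end

section \<open>Quasi-geodesic orbits are the non-tangential ones\<close>

theorem corollary1p1:
  fixes f :: "complex \<Rightarrow> complex"
  assumes "non_elliptic f"
  shows "(\<forall>z\<in>unit_disc. \<exists>A B :: real. A \<ge> 1 \<and> B \<ge> 0 \<and>
            (\<forall>n m :: nat. n < m \<longrightarrow>
              (\<Sum>k=n..<m. hyp_dist ((f ^^ k) z) ((f ^^ (k + 1)) z))
                \<le> A * hyp_dist ((f ^^ n) z) ((f ^^ m) z) + B))
     \<longleftrightarrow> (\<exists>z\<in>unit_disc.
            converges_nontangentially (\<lambda>n. (f ^^ n) z) (denjoy_wolff_point f))"
    (is "(\<forall>z\<in>unit_disc. ?quasi_geodesic z) \<longleftrightarrow> _")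
proof -
  have f: "f holomorphic_on unit_disc" "f ` unit_disc \<subseteq> unit_disc"
    and nofix: "\<forall>z\<in>unit_disc. f z \<noteq> z"
    using assms by (auto simp: non_elliptic_def)
  obtain \<tau> where \<tau>: "norm \<tau> = 1"
    and Wolff: "\<And>z. norm z < 1 \<Longrightarrow> Re (cayley \<tau> z) \<le> Re (cayley \<tau> (f z))"
    using Wolff_boundary_point[OF f nofix] by blast
  interpret disc_map_with_wolff_point f \<tau>
    using f \<tau> Wolff by unfold_locales
  have conv: "(\<lambda>n. (f ^^ n) z) \<longlonglongrightarrow> \<tau>" if "norm z < 1" for z
    using Denjoy_Wolff_convergence[OF f nofix \<tau> Wolff that] .
  have dw: "denjoy_wolff_point f = \<tau>" using denjoy_wolff_point_eqI[OF \<tau> conv] .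
  have sector: "converges_nontangentially (\<lambda>n. (f ^^ n) z) \<tau>
      \<longleftrightarrow> (\<exists>K. \<forall>n. norm (hp_orbit z n + 1) \<le> K * Re (hp_orbit z n))" if "norm z < 1" for z
    unfolding hp_orbit_def
    by (rule converges_nontangentially_iff_sector[OF \<tau> orbit_in_disc[OF that] conv[OF that]])
  show ?thesis
    unfolding dw
  proof
    assume qg: "\<forall>z\<in>unit_disc. ?quasi_geodesic z"
    have 0: "norm (0 :: complex) < 1" by simp
    obtain A B where "A \<ge> 1" and AB: "\<And>n m. n < m \<Longrightarrow>
        (\<Sum>k=n..<m. hyp_dist ((f ^^ k) 0) ((f ^^ (k + 1)) 0))
          \<le> A * hyp_dist ((f ^^ n) 0) ((f ^^ m) 0) + B"
      using bspec[OF qg, of 0] by auto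
    then have "A > 0" by simp
    then obtain K where "\<And>n. norm (hp_orbit 0 n + 1) \<le> K * Re (hp_orbit 0 n)"
      using quasi_geodesic_orbit_imp_sector[OF 0 _ AB] by blast
    then show "\<exists>z\<in>unit_disc. converges_nontangentially (\<lambda>n. (f ^^ n) z) \<tau>"
      using sector[OF 0] by (intro bexI[of _ 0]) auto
  next
    assume "\<exists>z\<in>unit_disc. converges_nontangentially (\<lambda>n. (f ^^ n) z) \<tau>"
    then obtain z0 K where z0: "norm z0 < 1"
      and K: "\<And>n. norm (hp_orbit z0 n + 1) \<le> K * Re (hp_orbit z0 n)"
      using sector by (metis mem_ball_0)
    show "\<forall>z\<in>unit_disc. ?quasi_geodesic z"
    proof
      fix z :: complex assume "z \<in> unit_disc"
      then have z: "norm z < 1" by simp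
      obtain R where "\<And>n. norm (hp_orbit z n + 1) \<le> R * Re (hp_orbit z n)"
        using sector_transfer[OF z0 z K] by blast
      then obtain A where "A \<ge> 1" "\<And>n m. n < m \<Longrightarrow>
          (\<Sum>k=n..<m. hyp_dist ((f ^^ k) z) ((f ^^ (k + 1)) z))
            \<le> A * hyp_dist ((f ^^ n) z) ((f ^^ m) z)"
        using sector_orbit_imp_quasi_geodesic[OF z conv[OF z]] by blast
      then show "?quasi_geodesic z"
        by (intro exI[of _ A] exI[of _ 0]) auto
    qed
  qed
qed

end
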